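(* The axiom DIM is not provable in RCA$_0$ + VSMALL; i.e., there is an $\omega$-model of RCA$_0$ + VSMALL in which DIM fails.
   Context: A tree is a subset of $2^{<\mathbb{N}}$ closed under initial segments. A node $\sigma\in T$ is extendible if $\{\tau\in T:\tau\supseteq\sigma\}$ is infinite; $\mathrm{Ext}(T)$ is the set of extendible nodes. $\sigma\in T$ is a branching node if $\sigma0$ and $\sigma1$ are both extendible; $\mathrm{Br}(T)$ is the set of branching nodes. VSMALL is the axiom: if $T$ is an infinite binary tree such that there is no function $f:\mathbb{N}\to\mathbb{N}$ such that for infinitely many $n$ the set $\{|\sigma|:\sigma\in\mathrm{Br}(T),\ |\sigma|<f(n)\}$ has at least $n$ elements, then $T$ has an infinite path. DIM is the axiom: if $T$ is an infinite binary tree such that there is no function $f:\mathbb{N}\to\mathbb{N}$ with $\forall\sigma\in\mathrm{Ext}(T)\ \exists\tau\in\mathrm{Br}(T)\,[\tau\supseteq\sigma\wedge|\tau|\le f(|\sigma|)]$, then $T$ has an infinite path. *)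

theory Defs
  imports Main "HOL-Library.Nat_Bijection" "HOL-Library.Sublist"
begin

datatype rf = Zero | Succ | Proj nat | Orc | Comp rf "rf list" | PrimRec rf rf | Mu rf

inductive eval :: "nat set \<Rightarrow> rf \<Rightarrow> nat list \<Rightarrow> nat \<Rightarrow> bool" for A :: "nat set" where
  ev_zero: "eval A Zero xs 0"
| ev_succ: "eval A Succ (x # xs) (Suc x)"
| ev_proj: "i < length xs \<Longrightarrow> eval A (Proj i) xs (xs ! i)"
| ev_orc: "eval A Orc (x # xs) (if x \<in> A then 1 else 0)"
| ev_comp: "length ys = length gs \<Longrightarrow> (\<forall>i < length gs. eval A (gs ! i) xs (ys ! i))
             \<Longrightarrow> eval A f ys z \<Longrightarrow> eval A (Comp f gs) xs z"
| ev_prec0: "eval A g xs z \<Longrightarrow> eval A (PrimRec g h) (0 # xs) z"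
| ev_precS: "eval A (PrimRec g h) (n # xs) y \<Longrightarrow> eval A h (n # y # xs) z
             \<Longrightarrow> eval A (PrimRec g h) (Suc n # xs) z"
| ev_mu: "eval A f (n # xs) 0 \<Longrightarrow> (\<forall>m < n. \<exists>y. y \<noteq> 0 \<and> eval A f (m # xs) y)
             \<Longrightarrow> eval A (Mu f) xs n"

definition turing_reducible :: "nat set \<Rightarrow> nat set \<Rightarrow> bool" where
  "turing_reducible B A \<longleftrightarrow> (\<exists>f. \<forall>x. eval A f [x] (if x \<in> B then 1 else 0))"

definition tjoin :: "nat set \<Rightarrow> nat set \<Rightarrow> nat set" where
  "tjoin A B = {2 * n | n. n \<in> A} \<union> {2 * n + 1 | n. n \<in> B}"

text \<open>omega-models of RCA0 are exactly the Turing ideals.\<close>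
definition turing_ideal :: "nat set set \<Rightarrow> bool" where
  "turing_ideal M \<longleftrightarrow> M \<noteq> {}
     \<and> (\<forall>A\<in>M. \<forall>B\<in>M. tjoin A B \<in> M)
     \<and> (\<forall>A\<in>M. \<forall>B. turing_reducible B A \<longrightarrow> B \<in> M)"

text \<open>Bijective coding of 2^{<N} into N.\<close>
fun bcode :: "bool list \<Rightarrow> nat" where
  "bcode [] = 0"
| "bcode (b # s) = 2 * bcode s + (if b then 2 else 1)"

definition is_tree :: "bool list set \<Rightarrow> bool" where
  "is_tree T \<longleftrightarrow> (\<forall>\<tau>\<in>T. \<forall>\<sigma>. prefix \<sigma> \<tau> \<longrightarrow> \<sigma> \<in> T)"

definition Ext :: "bool list set \<Rightarrow> bool list set" where
  "Ext T = {\<sigma>\<in>T. infinite {\<tau>\<in>T. prefix \<sigma> \<tau>}}"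

definition Br :: "bool list set \<Rightarrow> bool list set" where
  "Br T = {\<sigma>\<in>T. \<sigma> @ [False] \<in> Ext T \<and> \<sigma> @ [True] \<in> Ext T}"

definition tree_in :: "nat set set \<Rightarrow> bool list set \<Rightarrow> bool" where
  "tree_in M T \<longleftrightarrow> bcode ` T \<in> M"

definition fun_in :: "nat set set \<Rightarrow> (nat \<Rightarrow> nat) \<Rightarrow> bool" where
  "fun_in M f \<longleftrightarrow> {prod_encode (n, f n) | n. True} \<in> M"

definition is_path :: "bool list set \<Rightarrow> (nat \<Rightarrow> bool) \<Rightarrow> bool" where
  "is_path T p \<longleftrightarrow> (\<forall>n. map p [0..<n] \<in> T)"

definition path_in :: "nat set set \<Rightarrow> (nat \<Rightarrow> bool) \<Rightarrow> bool" where
  "path_in M p \<longleftrightarrow> {n. p n} \<in> M"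

definition VSMALL_hyp :: "nat set set \<Rightarrow> bool list set \<Rightarrow> bool" where
  "VSMALL_hyp M T \<longleftrightarrow> \<not> (\<exists>f. fun_in M f \<and>
      infinite {n. n \<le> card {length \<sigma> | \<sigma>. \<sigma> \<in> Br T \<and> length \<sigma> < f n}})"

definition VSMALL_holds :: "nat set set \<Rightarrow> bool" where
  "VSMALL_holds M \<longleftrightarrow> (\<forall>T. tree_in M T \<and> is_tree T \<and> infinite T \<and> VSMALL_hyp M T
      \<longrightarrow> (\<exists>p. path_in M p \<and> is_path T p))"

definition DIM_hyp :: "nat set set \<Rightarrow> bool list set \<Rightarrow> bool" where
  "DIM_hyp M T \<longleftrightarrow> \<not> (\<exists>f. fun_in M f \<and>
      (\<forall>\<sigma>\<in>Ext T. \<exists>\<tau>\<in>Br T. prefix \<sigma> \<tau> \<and> length \<tau> \<le> f (length \<sigma>)))"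

definition DIM_holds :: "nat set set \<Rightarrow> bool" where
  "DIM_holds M \<longleftrightarrow> (\<forall>T. tree_in M T \<and> is_tree T \<and> infinite T \<and> DIM_hyp M T
      \<longrightarrow> (\<exists>p. path_in M p \<and> is_path T p))"

end

theory Submission
  imports Defs "HOL-Library.Countable" "HOL-Library.Infinite_Set"
begin

text \<open>
  Turing functionals are replaced by a countable family of continuous operators that contains them
  and is closed under composition, join and the projections needed for Cohen forcing. Call a tree
  $T$ generic if no operator enumerates, from $T$, a nonempty set of finite sequences without dead
  ends consisting of initial segments of paths of $T$ or of bounds as in DIM. Such a tree is built
  by finite approximations: split every node of the top level, wait for the operator to commit to
  a long sequence, then kill the split node that it chose and let every other chosen node grow
  without branching beyond the proposed bound.

  Cohen forcing preserves the invariant, because the sequences that some extension of a condition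
  enumerates are already enumerated from the ground set. Iterating $\omega$ times yields a Turing
  ideal in which DIM fails at $T$. Each Cohen function escapes the branching levels of every
  tree of the previous stage, so only trees with finitely many branching levels satisfy the
  hypothesis of VSMALL, and those have isolated, hence computable, paths.
\<close>

section \<open>Continuous operators\<close>

text \<open>
  Operators only see positive information, so a set is given to them by its characteristic function.
\<close>

definition char_graph :: "nat set \<Rightarrow> nat set" where
  "char_graph B = {2 * x + of_bool (x \<in> B) | x. True}"

lemma double_of_bool_eq_iff:
  "2 * (x::nat) + of_bool b = 2 * y + of_bool c \<longleftrightarrow> x = y \<and> b = c"
  by (cases b; cases c; simp; presburger)

lemma double_of_bool_cases: obtains x b where "(n::nat) = 2 * x + of_bool b"
proof
  show "n = 2 * (n div 2) + of_bool (odd n)"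
    by (cases "odd n") auto
qed

lemma in_char_graph_iff: "2 * x + of_bool b \<in> char_graph B \<longleftrightarrow> (b \<longleftrightarrow> x \<in> B)"
  by (auto simp: char_graph_def double_of_bool_eq_iff)

lemma char_graph_eqI:
  assumes "\<And>x b. 2 * x + of_bool b \<in> W \<longleftrightarrow> (b \<longleftrightarrow> x \<in> B)"
  shows "W = char_graph B"
  using assms in_char_graph_iff double_of_bool_cases by (metis subsetI subset_antisym)

lemma char_graph_mem1: "Suc (2 * x) \<in> char_graph B \<longleftrightarrow> x \<in> B"
  using in_char_graph_iff[of x True B] by simp

lemma char_graph_mem0: "2 * x \<in> char_graph B \<longleftrightarrow> x \<notin> B"
  using in_char_graph_iff[of x False B] by simp

lemma tjoin_simps [simp]:
  "2 * x \<in> tjoin A B \<longleftrightarrow> x \<in> A" "Suc (2 * x) \<in> tjoin A B \<longleftrightarrow> x \<in> B"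
  unfolding tjoin_def by (auto, presburger+)

lemma tjoin_mono: "A \<subseteq> A' \<Longrightarrow> B \<subseteq> B' \<Longrightarrow> tjoin A B \<subseteq> tjoin A' B'"
  unfolding tjoin_def by blast

text \<open>Scott continuity on the power set of the naturals: one equivalence packs monotonicity
  together with the dependence of each output on a finite part of the input.\<close>

definition finitary :: "(nat set \<Rightarrow> nat set) \<Rightarrow> bool" where
  "finitary \<Theta> \<longleftrightarrow> (\<forall>W x. x \<in> \<Theta> W \<longleftrightarrow> (\<exists>D. finite D \<and> D \<subseteq> W \<and> x \<in> \<Theta> D))"

lemma finitary_mono: "finitary \<Theta> \<Longrightarrow> V \<subseteq> W \<Longrightarrow> \<Theta> V \<subseteq> \<Theta> W"
  unfolding finitary_def by (meson subset_iff subset_trans)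

lemma finitaryD: "finitary \<Theta> \<Longrightarrow> x \<in> \<Theta> W \<Longrightarrow> \<exists>D. finite D \<and> D \<subseteq> W \<and> x \<in> \<Theta> D"
  unfolding finitary_def by blast

lemma finitary_finite_subset:
  assumes \<Theta>: "finitary \<Theta>" and "finite E" "E \<subseteq> \<Theta> W"
  shows "\<exists>D. finite D \<and> D \<subseteq> W \<and> E \<subseteq> \<Theta> D"
  using assms(2,3)
proof (induction E)
  case (insert x E)
  then obtain D D' where "finite D" "D \<subseteq> W" "E \<subseteq> \<Theta> D" "finite D'" "D' \<subseteq> W" "x \<in> \<Theta> D'"
    using \<Theta> unfolding finitary_def by (metis insert_subset)
  then have "finite (D \<union> D')" "D \<union> D' \<subseteq> W" "insert x E \<subseteq> \<Theta> (D \<union> D')"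
    using finitary_mono[OF \<Theta>, of D "D \<union> D'"] finitary_mono[OF \<Theta>, of D' "D \<union> D'"] by auto
  then show ?case by blast
qed auto

lemma finitaryI:
  assumes "\<And>V W. V \<subseteq> W \<Longrightarrow> \<Theta> V \<subseteq> \<Theta> W"
    and "\<And>W x. x \<in> \<Theta> W \<Longrightarrow> \<exists>D. finite D \<and> D \<subseteq> W \<and> x \<in> \<Theta> D"
  shows "finitary \<Theta>"
  using assms unfolding finitary_def by blast

lemma finitaryI_singleton:
  assumes "\<And>V W. V \<subseteq> W \<Longrightarrow> \<Theta> V \<subseteq> \<Theta> W" and "\<And>W x. x \<in> \<Theta> W \<Longrightarrow> \<exists>y\<in>W. x \<in> \<Theta> {y}"
  shows "finitary \<Theta>"
  by (rule finitaryI) (use assms in \<open>blast, meson empty_subsetI finite.emptyI finite.insertI insert_subset\<close>)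

text \<open>A finite subset of an increasing union lies in one member. The bound \<open>m\<close>
  lets that member be taken as far out as a construction requires.\<close>

lemma finitary_directed_Union:
  assumes \<Theta>: "finitary \<Theta>" and "x \<in> \<Theta> W" and W: "W \<subseteq> (\<Union>n. S n)" and "mono (S :: nat \<Rightarrow> nat set)"
  obtains n where "n \<ge> m" "x \<in> \<Theta> (S n)"
proof -
  obtain D where D: "finite D" "D \<subseteq> W" "x \<in> \<Theta> D"
    using assms(1,2) unfolding finitary_def by blast
  have "\<exists>n\<ge>m. D \<subseteq> S n" using D(1) order_trans[OF D(2) W]
  proof (induction D)
    case (insert d D)
    then obtain n n' where "n \<ge> m" "D \<subseteq> S n" "d \<in> S n'" by auto
    moreover have "S n \<subseteq> S (max n n')" "S n' \<subseteq> S (max n n')"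
      using \<open>mono S\<close> by (simp_all add: monoD)
    ultimately show ?case by (intro exI[of _ "max n n'"]) auto
  qed auto
  then show thesis using that D(3) finitary_mono[OF \<Theta>] by blast
qed

subsection \<open>Oracle computations\<close>

lemma eval_deterministic: "eval A f xs y \<Longrightarrow> eval A f xs z \<Longrightarrow> y = z"
proof (induction arbitrary: z rule: eval.induct)
  case (ev_comp ys gs xs f w)
  from ev_comp.prems obtain ys' where ys': "length ys' = length gs"
    "\<forall>i<length gs. eval A (gs ! i) xs (ys' ! i)" "eval A f ys' z"
    by (cases rule: eval.cases) auto
  then have "ys = ys'" using ev_comp by (intro nth_equalityI) auto
  then show ?case using ev_comp ys' by blast
next
  case (ev_prec0 g xs w h)
  from ev_prec0.prems show ?case by (cases rule: eval.cases) (auto intro: ev_prec0)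
next
  case (ev_precS g h n xs y w)
  from ev_precS.prems obtain y' where "eval A (PrimRec g h) (n # xs) y'" "eval A h (n # y' # xs) z"
    by (cases rule: eval.cases) auto
  then show ?case using ev_precS.IH by blast
next
  case (ev_mu f n xs)
  from ev_mu.prems have z: "eval A f (z # xs) 0" "\<forall>m<z. \<exists>y. y \<noteq> 0 \<and> eval A f (m # xs) y"
    by (cases rule: eval.cases; auto)+
  \<comment> \<open>Of two distinct results of the search, the smaller would be both a zero and a
    non-zero of the searched function.\<close>
  show ?case
  proof (rule ccontr)
    assume "n \<noteq> z"
    then consider "n < z" | "z < n" by linarith
    then show False
    proof cases
      case 1
      then show False using z ev_mu.IH by (metis)
    next
      case 2
      then show False using z ev_mu.IH by (metis)
    qed
  qed
qed (auto elim: eval.cases)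

text \<open>The use principle: a halting computation asks the oracle finitely often. The answers,
  negative ones included, are elements of the characteristic graph, and \<open>D\<close> collects
  them.\<close>

lemma eval_use:
  "eval A f xs y \<Longrightarrow>
    \<exists>D. finite D \<and> D \<subseteq> char_graph A \<and> (\<forall>B. D \<subseteq> char_graph B \<longrightarrow> eval B f xs y)"
proof (induction rule: eval.induct)
  case (ev_orc x xs)
  have "eval B Orc (x # xs) (if x \<in> A then 1 else 0)"
    if "2 * x + of_bool (x \<in> A) \<in> char_graph B" for B
    using that eval.ev_orc[of B x xs] by (simp add: in_char_graph_iff)
  then show ?case
    by (intro exI[of _ "{2 * x + of_bool (x \<in> A)}"]) (auto simp: in_char_graph_iff)
next
  case (ev_comp ys gs xs f z)
  then obtain D E where D: "\<And>i. i < length gs \<Longrightarrow> finite (D i) \<and> D i \<subseteq> char_graph A \<and>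
      (\<forall>B. D i \<subseteq> char_graph B \<longrightarrow> eval B (gs ! i) xs (ys ! i))"
    and E: "finite E" "E \<subseteq> char_graph A" "\<And>B. E \<subseteq> char_graph B \<Longrightarrow> eval B f ys z"
    by metis
  have "eval B (Comp f gs) xs z" if "E \<union> (\<Union>i<length gs. D i) \<subseteq> char_graph B" for B
  proof (rule eval.ev_comp)
    show "eval B f ys z" using that E(3) by simp
    have "D i \<subseteq> char_graph B" if "i < length gs" for i
      using that \<open>E \<union> _ \<subseteq> _\<close> by blast
    then show "\<forall>i<length gs. eval B (gs ! i) xs (ys ! i)" using D by blast
  qed (fact ev_comp(1))
  then show ?case using D E
    by (intro exI[of _ "E \<union> (\<Union>i<length gs. D i)"]) auto
next
  case (ev_precS g h n xs y z)
  then obtain D E where "finite D" "D \<subseteq> char_graph A"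
    "\<And>B. D \<subseteq> char_graph B \<Longrightarrow> eval B (PrimRec g h) (n # xs) y"
    "finite E" "E \<subseteq> char_graph A" "\<And>B. E \<subseteq> char_graph B \<Longrightarrow> eval B h (n # y # xs) z"
    by metis
  then show ?case by (intro exI[of _ "D \<union> E"]) (blast intro: eval.ev_precS)
next
  case (ev_mu f n xs)
  then obtain E where E: "finite E" "E \<subseteq> char_graph A" "\<And>B. E \<subseteq> char_graph B \<Longrightarrow> eval B f (n # xs) 0"
    by metis
  from ev_mu have "\<forall>m<n. \<exists>y D. y \<noteq> 0 \<and> finite D \<and> D \<subseteq> char_graph A \<and>
      (\<forall>B. D \<subseteq> char_graph B \<longrightarrow> eval B f (m # xs) y)" by metis
  then obtain y D where D: "\<And>m. m < n \<Longrightarrow> y m \<noteq> (0::nat) \<and> finite (D m) \<and> D m \<subseteq> char_graph A \<and>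
      (\<forall>B. D m \<subseteq> char_graph B \<longrightarrow> eval B f (m # xs) (y m))" by metis
  have "eval B (Mu f) xs n" if B: "E \<union> (\<Union>i<n. D i) \<subseteq> char_graph B" for B
  proof (rule eval.ev_mu)
    show "eval B f (n # xs) 0" using B E by simp
    have "D m \<subseteq> char_graph B" if "m < n" for m using B that by blast
    then show "\<forall>m<n. \<exists>y. y \<noteq> 0 \<and> eval B f (m # xs) y" using D by blast
  qed
  then show ?case using D E
    by (intro exI[of _ "E \<union> (\<Union>i<n. D i)"]) auto
qed (meson eval.intros empty_subsetI finite.emptyI)+

text \<open>Computation from partial information is expressed through total oracles: all those
  compatible with a finite part of \<open>W\<close> must agree. If none is compatible, both bits are
  output, so an inconsistent \<open>W\<close> does no harm to continuity.\<close>

definition turing_op :: "rf \<Rightarrow> nat set \<Rightarrow> nat set" where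
  "turing_op e W = {2 * x + of_bool b | x b. \<exists>D. finite D \<and> D \<subseteq> W \<and>
     (\<forall>B. D \<subseteq> char_graph B \<longrightarrow> eval B e [x] (of_bool b))}"

lemma finitary_turing_op: "finitary (turing_op e)"
proof (rule finitaryI)
  show "turing_op e V \<subseteq> turing_op e W" if "V \<subseteq> W" for V W
    unfolding turing_op_def using order_trans[OF _ that] by blast
  fix W x assume "x \<in> turing_op e W"
  then obtain D where "finite D" "D \<subseteq> W" "x \<in> turing_op e D"
    unfolding turing_op_def by blast
  then show "\<exists>D. finite D \<and> D \<subseteq> W \<and> x \<in> turing_op e D" by blast
qed

lemma turing_op_char_graph:
  assumes "\<forall>x. eval B e [x] (if x \<in> C then 1 else 0)"
  shows "turing_op e (char_graph B) = char_graph C"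
proof (rule char_graph_eqI)
  fix x b
  have "2 * x + of_bool b \<in> turing_op e (char_graph B) \<longleftrightarrow> eval B e [x] (of_bool b)"
  proof
    assume "2 * x + of_bool b \<in> turing_op e (char_graph B)"
    then obtain D where "D \<subseteq> char_graph B" "\<And>B. D \<subseteq> char_graph B \<Longrightarrow> eval B e [x] (of_bool b)"
      unfolding turing_op_def mem_Collect_eq double_of_bool_eq_iff by blast
    then show "eval B e [x] (of_bool b)" by blast
  next
    assume "eval B e [x] (of_bool b)"
    then have "\<exists>D. finite D \<and> D \<subseteq> char_graph B \<and>
        (\<forall>B. D \<subseteq> char_graph B \<longrightarrow> eval B e [x] (of_bool b))" by (rule eval_use)
    then show "2 * x + of_bool b \<in> turing_op e (char_graph B)"
      unfolding turing_op_def mem_Collect_eq by (intro exI[of _ x] exI[of _ b] conjI refl)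
  qed
  also have "\<dots> \<longleftrightarrow> (b \<longleftrightarrow> x \<in> C)"
  proof
    assume "eval B e [x] (of_bool b)"
    then have "(if x \<in> C then 1 else 0) = (of_bool b :: nat)"
      using assms eval_deterministic by blast
    then show "b \<longleftrightarrow> x \<in> C" by (cases b) (auto split: if_splits)
  next
    assume "b \<longleftrightarrow> x \<in> C"
    then show "eval B e [x] (of_bool b)" using assms[rule_format, of x] by (auto split: if_splits)
  qed
  finally show "2 * x + of_bool b \<in> turing_op e (char_graph B) \<longleftrightarrow> (b \<longleftrightarrow> x \<in> C)" .
qed

subsection \<open>A countable family of operators\<close>

text \<open>
  The bit at \<open>n\<close> of a path through \<open>\<sigma>\<close> is \<open>b\<close> as soon as, at some level, all extensions of \<open>\<sigma>\<close> with
  the other bit have been seen to leave the tree.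
\<close>

definition path_op :: "bool list \<Rightarrow> nat set \<Rightarrow> nat set" where
  "path_op \<sigma> W = {2 * n + of_bool b | n b. \<exists>m\<ge>length \<sigma>. n < m \<and>
     (\<forall>\<tau>. length \<tau> = m \<and> prefix \<sigma> \<tau> \<longrightarrow> 2 * bcode \<tau> \<in> W \<or> \<tau> ! n = b)}"

text \<open>On a characteristic graph only the initial segments of one 0-1 sequence remain; on an
  inconsistent set the segments may branch.\<close>

definition path_segs :: "nat set \<Rightarrow> nat set" where
  "path_segs W = {list_encode s | s. \<forall>i<length s. s ! i \<le> 1 \<and> 2 * i + s ! i \<in> W}"

definition fun_segs :: "nat set \<Rightarrow> nat set" where
  "fun_segs W = {list_encode s | s. \<forall>i<length s. Suc (2 * prod_encode (i, s ! i)) \<in> W}"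

definition join_op :: "nat set \<Rightarrow> nat set \<Rightarrow> nat set" where
  "join_op V W = {2 * (2 * x) + of_bool b | x b. 2 * x + of_bool b \<in> V} \<union>
     {2 * Suc (2 * x) + of_bool b | x b. 2 * x + of_bool b \<in> W}"

text \<open>Infinite for every nonempty \<open>g\<close>: the negative facts for all values other
  than \<open>g ! i\<close> are included. Without them the segments of a function would not exhaust
  the characteristic graph of its graph.\<close>

definition seg_graph :: "nat list \<Rightarrow> nat set" where
  "seg_graph g = {2 * prod_encode (i, y) + of_bool (y = g ! i) | i y. i < length g}"

text \<open>Syntax makes the family visibly countable, so that requirements can be met one by one.
  \<open>Cohen g a\<close> collects all that \<open>a\<close> outputs on some extension of the
  condition \<open>g\<close>; closure under it carries \<open>avoids\<close> through a Cohen
  extension.\<close>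

datatype code = Ident | Left | Right | Turing rf | Path "bool list" | Path_Segs | Fun_Segs
  | Compose code code | Join code code | Cohen "nat list" code

instance rf :: countable
  by countable_datatype

instance code :: countable
  by countable_datatype

fun ap :: "code \<Rightarrow> nat set \<Rightarrow> nat set" where
  "ap Ident W = W"
| "ap Left W = {x. 2 * x \<in> W}"
| "ap Right W = {x. Suc (2 * x) \<in> W}"
| "ap (Turing e) W = turing_op e W"
| "ap (Path \<sigma>) W = path_op \<sigma> W"
| "ap Path_Segs W = path_segs W"
| "ap Fun_Segs W = fun_segs W"
| "ap (Compose a b) W = ap a (ap b W)"
| "ap (Join a b) W = join_op (ap a W) (ap b W)"
| "ap (Cohen g a) W = (\<Union>h\<in>{h. prefix g h}. ap a (tjoin W (seg_graph h)))"

section \<open>Continuity of the coded operators\<close>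

lemma finite_bool_lists_length_eq: "finite {\<tau> :: bool list. length \<tau> = m}"
  using finite_lists_length_eq[of "UNIV :: bool set" m] by simp

lemma finitary_path_op: "finitary (path_op \<sigma>)"
proof (rule finitaryI)
  fix W x assume "x \<in> path_op \<sigma> W"
  then obtain n b m where x: "x = 2 * n + of_bool b" "m \<ge> length \<sigma>" "n < m"
    and m: "\<And>\<tau>. length \<tau> = m \<Longrightarrow> prefix \<sigma> \<tau> \<Longrightarrow> 2 * bcode \<tau> \<in> W \<or> \<tau> ! n = b"
    unfolding path_op_def by blast
  define D where "D = (\<lambda>\<tau>. 2 * bcode \<tau>) ` {\<tau>. length \<tau> = m} \<inter> W"
  have "finite D" unfolding D_def using finite_bool_lists_length_eq by blast
  moreover have "x \<in> path_op \<sigma> D" unfolding path_op_def D_def using x m by blast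
  ultimately show "\<exists>D. finite D \<and> D \<subseteq> W \<and> x \<in> path_op \<sigma> D" unfolding D_def by blast
next
  fix V W :: "nat set" assume "V \<subseteq> W"
  then have "2 * bcode \<tau> \<in> V \<or> P \<Longrightarrow> 2 * bcode \<tau> \<in> W \<or> P" for \<tau> P by blast
  then show "path_op \<sigma> V \<subseteq> path_op \<sigma> W"
    unfolding path_op_def by (intro Collect_mono ex_mono conj_mono imp_mono all_mono impI) blast+
qed

lemma finitary_path_segs: "finitary path_segs"
proof (rule finitaryI)
  fix W x assume "x \<in> path_segs W"
  then obtain s where s: "x = list_encode s" "\<forall>i<length s. s ! i \<le> 1 \<and> 2 * i + s ! i \<in> W"
    unfolding path_segs_def by blast
  then have "x \<in> path_segs ((\<lambda>i. 2 * i + s ! i) ` {..<length s})"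
    unfolding path_segs_def by blast
  moreover have "(\<lambda>i. 2 * i + s ! i) ` {..<length s} \<subseteq> W" using s(2) by auto
  ultimately show "\<exists>D. finite D \<and> D \<subseteq> W \<and> x \<in> path_segs D" by (meson finite_imageI finite_lessThan)
qed (unfold path_segs_def, blast)

lemma finitary_fun_segs: "finitary fun_segs"
proof (rule finitaryI)
  fix W x assume "x \<in> fun_segs W"
  then obtain s where s: "x = list_encode s" "\<forall>i<length s. Suc (2 * prod_encode (i, s ! i)) \<in> W"
    unfolding fun_segs_def by blast
  then have "x \<in> fun_segs ((\<lambda>i. Suc (2 * prod_encode (i, s ! i))) ` {..<length s})"
    unfolding fun_segs_def by blast
  moreover have "(\<lambda>i. Suc (2 * prod_encode (i, s ! i))) ` {..<length s} \<subseteq> W" using s(2) by auto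
  ultimately show "\<exists>D. finite D \<and> D \<subseteq> W \<and> x \<in> fun_segs D" by (meson finite_imageI finite_lessThan)
qed (unfold fun_segs_def, blast)

lemma finitary_compose:
  assumes "finitary \<Theta>" "finitary \<Psi>"
  shows "finitary (\<lambda>W. \<Theta> (\<Psi> W))"
proof (rule finitaryI)
  show "\<Theta> (\<Psi> V) \<subseteq> \<Theta> (\<Psi> W)" if "V \<subseteq> W" for V W
    using that assms by (simp add: finitary_mono)
next
  fix W x assume "x \<in> \<Theta> (\<Psi> W)"
  then obtain E where E: "finite E" "E \<subseteq> \<Psi> W" "x \<in> \<Theta> E"
    using finitaryD[OF assms(1)] by metis
  then obtain D where D: "finite D" "D \<subseteq> W" "E \<subseteq> \<Psi> D"
    using finitary_finite_subset[OF assms(2)] by metis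
  then have "x \<in> \<Theta> (\<Psi> D)" using finitary_mono[OF assms(1)] E(3) by blast
  then show "\<exists>D. finite D \<and> D \<subseteq> W \<and> x \<in> \<Theta> (\<Psi> D)" using D by blast
qed

lemma join_op_mono: "U \<subseteq> U' \<Longrightarrow> V \<subseteq> V' \<Longrightarrow> join_op U V \<subseteq> join_op U' V'"
  unfolding join_op_def by blast

lemma finitary_join:
  assumes "finitary \<Theta>" "finitary \<Psi>"
  shows "finitary (\<lambda>W. join_op (\<Theta> W) (\<Psi> W))"
proof (rule finitaryI)
  show "join_op (\<Theta> V) (\<Psi> V) \<subseteq> join_op (\<Theta> W) (\<Psi> W)" if "V \<subseteq> W" for V W
    using that assms by (simp add: finitary_mono join_op_mono)
next
  fix W x assume "x \<in> join_op (\<Theta> W) (\<Psi> W)"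
  then consider y where "y \<in> \<Theta> W" "x \<in> join_op {y} {}" | y where "y \<in> \<Psi> W" "x \<in> join_op {} {y}"
    unfolding join_op_def by blast
  then show "\<exists>D. finite D \<and> D \<subseteq> W \<and> x \<in> join_op (\<Theta> D) (\<Psi> D)"
  proof cases
    case 1
    then obtain D where D: "finite D" "D \<subseteq> W" "y \<in> \<Theta> D" using finitaryD[OF assms(1)] by metis
    then have "x \<in> join_op (\<Theta> D) (\<Psi> D)" using 1 join_op_mono[of "{y}" "\<Theta> D" "{}"] by blast
    then show ?thesis using D by blast
  next
    case 2
    then obtain D where D: "finite D" "D \<subseteq> W" "y \<in> \<Psi> D" using finitaryD[OF assms(2)] by metis
    then have "x \<in> join_op (\<Theta> D) (\<Psi> D)" using 2 join_op_mono[of "{}" _ "{y}" "\<Psi> D"] by blast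
    then show ?thesis using D by blast
  qed
qed

text \<open>Only \<open>W\<close> varies here. The second component is a fixed set, which may be
  infinite as \<open>seg_graph\<close> is.\<close>

lemma finitary_tjoin: "finitary (\<lambda>W. tjoin W S)"
proof (rule finitaryI)
  show "tjoin V S \<subseteq> tjoin W S" if "V \<subseteq> W" for V W using that tjoin_mono by blast
next
  fix W x assume "x \<in> tjoin W S"
  then consider n where "x = 2 * n" "n \<in> W" | "x \<in> tjoin {} S" unfolding tjoin_def by blast
  then show "\<exists>D. finite D \<and> D \<subseteq> W \<and> x \<in> tjoin D S"
  proof cases
    case 1
    then show ?thesis by (intro exI[of _ "{n}"]) simp
  next
    case 2
    then show ?thesis by blast
  qed
qed

lemma finitary_Union:
  assumes "\<And>i. i \<in> I \<Longrightarrow> finitary (\<Theta> i)"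
  shows "finitary (\<lambda>W. \<Union>i\<in>I. \<Theta> i W)"
proof (rule finitaryI)
  show "(\<Union>i\<in>I. \<Theta> i V) \<subseteq> (\<Union>i\<in>I. \<Theta> i W)" if "V \<subseteq> W" for V W
    using finitary_mono[OF assms that] by blast
next
  fix W x assume "x \<in> (\<Union>i\<in>I. \<Theta> i W)"
  then obtain i where i: "i \<in> I" "x \<in> \<Theta> i W" by blast
  then obtain D where "finite D" "D \<subseteq> W" "x \<in> \<Theta> i D" using finitaryD[OF assms] by metis
  then show "\<exists>D. finite D \<and> D \<subseteq> W \<and> x \<in> (\<Union>i\<in>I. \<Theta> i D)" using i by blast
qed

lemma finitary_ap: "finitary (ap a)"
proof (induction a)
  case Ident
  show ?case by (rule finitaryI_singleton) auto
next
  case Left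
  show ?case by (rule finitaryI_singleton) auto
next
  case Right
  show ?case by (rule finitaryI_singleton) auto
next
  case (Turing e)
  have "ap (Turing e) = turing_op e" by (rule ext) simp
  then show ?case by (simp only: finitary_turing_op)
next
  case (Path \<sigma>)
  have "ap (Path \<sigma>) = path_op \<sigma>" by (rule ext) simp
  then show ?case by (simp only: finitary_path_op)
next
  case Path_Segs
  have "ap Path_Segs = path_segs" by (rule ext) simp
  then show ?case by (simp only: finitary_path_segs)
next
  case Fun_Segs
  have "ap Fun_Segs = fun_segs" by (rule ext) simp
  then show ?case by (simp only: finitary_fun_segs)
next
  case (Cohen g a)
  have "ap (Cohen g a) = (\<lambda>W. \<Union>h\<in>{h. prefix g h}. ap a (tjoin W (seg_graph h)))"
    by (rule ext) simp
  then show ?case using finitary_Union[OF finitary_compose[OF Cohen finitary_tjoin]] by (simp only:)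
next
  case (Compose a b)
  have "ap (Compose a b) = (\<lambda>W. ap a (ap b W))" by (rule ext) simp
  then show ?case using finitary_compose[OF Compose] by (simp only:)
next
  case (Join a b)
  have "ap (Join a b) = (\<lambda>W. join_op (ap a W) (ap b W))" by (rule ext) simp
  then show ?case using finitary_join[OF Join] by (simp only:)
qed

lemmas ap_mono = finitary_mono[OF finitary_ap]

section \<open>Cohen extensions\<close>

text \<open>
  A set without dead ends, rather than a function, is what an operator may not produce: the
  union of such sets over all extensions of a Cohen condition is again of this kind, so no search
  for a single branch is needed.
\<close>

definition deadend_free :: "nat list set \<Rightarrow> nat set \<Rightarrow> bool" where
  "deadend_free P W \<longleftrightarrow> W \<noteq> {} \<and> (\<forall>w\<in>W. list_decode w \<in> P \<and>
     (\<exists>v\<in>W. strict_prefix (list_decode w) (list_decode v)))"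

definition avoids :: "nat list set \<Rightarrow> nat set \<Rightarrow> bool" where
  "avoids P Z \<longleftrightarrow> (\<forall>a. \<not> deadend_free P (ap a Z))"

definition fun_graph :: "(nat \<Rightarrow> nat) \<Rightarrow> nat set" where
  "fun_graph f = {prod_encode (n, f n) | n. True}"

lemma in_fun_graph_iff: "prod_encode (i, y) \<in> fun_graph f \<longleftrightarrow> y = f i"
  unfolding fun_graph_def by (auto dest: inj_prod_encode[THEN injD])

lemma seg_graph_subset: "seg_graph (map f [0..<n]) \<subseteq> char_graph (fun_graph f)"
  unfolding seg_graph_def by (auto simp only: in_char_graph_iff in_fun_graph_iff) auto

lemma char_graph_fun_graph_Union:
  "char_graph (fun_graph f) \<subseteq> (\<Union>n. seg_graph (map f [0..<n]))"
proof
  fix z assume "z \<in> char_graph (fun_graph f)"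
  then obtain x where x: "z = 2 * x + of_bool (x \<in> fun_graph f)" unfolding char_graph_def by blast
  obtain i y where iy: "x = prod_encode (i, y)" by (metis prod_decode_inverse surj_pair)
  have "z \<in> seg_graph (map f [0..<Suc i])"
    unfolding seg_graph_def x iy in_fun_graph_iff mem_Collect_eq
    by (intro exI[of _ i] exI[of _ y]) (simp del: upt_Suc)
  then show "z \<in> (\<Union>n. seg_graph (map f [0..<n]))" by blast
qed

lemma mono_seg_graph: "mono (\<lambda>n. seg_graph (map f [0..<n]))"
  unfolding mono_def seg_graph_def by fastforce

text \<open>An output from the full function is already forced by a finite segment; \<open>m\<close>
  allows one that extends a given condition.\<close>

lemma ap_tjoin_fun_graph:
  assumes "w \<in> ap a (tjoin Z (char_graph (fun_graph f)))"
  obtains n where "n \<ge> m" "w \<in> ap a (tjoin Z (seg_graph (map f [0..<n])))"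
proof -
  have "tjoin Z (char_graph (fun_graph f)) \<subseteq> (\<Union>n. tjoin Z (seg_graph (map f [0..<n])))"
    using char_graph_fun_graph_Union[of f] unfolding tjoin_def by blast
  moreover have "mono (\<lambda>n. tjoin Z (seg_graph (map f [0..<n])))"
    using mono_seg_graph[of f] tjoin_mono unfolding mono_def by (metis order_refl)
  ultimately show thesis
    using finitary_directed_Union[OF finitary_ap assms] that by metis
qed

text \<open>The set \<open>U\<close> of all that is enumerated under some extension of
  \<open>g\<close> is the output of \<open>Cohen g a\<close> from \<open>Z\<close>, so it has a
  defect, and a suitable \<open>h\<close> passes the defect on. If \<open>U\<close> is empty, so is
  each output above \<open>g\<close>. A bad sequence or a dead end of \<open>U\<close> is forced
  into the output by \<open>h\<close>; a dead end remains one because outputs above \<open>g\<close>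
  stay inside \<open>U\<close>.\<close>

lemma Cohen_step:
  assumes "avoids P Z"
  obtains h where "prefix g h" "\<And>f. h = map f [0..<length h] \<Longrightarrow>
    \<not> deadend_free P (ap a (tjoin Z (char_graph (fun_graph f))))"
proof -
  define U where "U = ap (Cohen g a) Z"
  have decided: "w \<in> ap a (tjoin Z (char_graph (fun_graph f)))"
    if "w \<in> ap a (tjoin Z (seg_graph h))" "h = map f [0..<length h]" for w h f
    using that ap_mono[OF tjoin_mono[OF order_refl seg_graph_subset]] by (metis subsetD)
  have in_U: "w \<in> U" if w: "w \<in> ap a (tjoin Z (char_graph (fun_graph f)))"
    and h: "prefix g h" "h = map f [0..<length h]" for w h f
  proof -
    obtain n where n: "n \<ge> length h" "w \<in> ap a (tjoin Z (seg_graph (map f [0..<n])))"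
      by (rule ap_tjoin_fun_graph[OF w])
    have "h = take (length h) (map f [0..<n])" using n(1) h(2) by (metis add_0 take_map take_upt)
    then have "prefix g (map f [0..<n])" by (metis take_is_prefix prefix_order.trans h(1))
    then show ?thesis unfolding U_def using n(2) by auto
  qed
  from assms have "\<not> deadend_free P U" unfolding avoids_def U_def by blast
  then consider "U = {}" | w where "w \<in> U" "list_decode w \<notin> P"
    | w where "w \<in> U" "\<not> (\<exists>v\<in>U. strict_prefix (list_decode w) (list_decode v))"
    unfolding deadend_free_def by blast
  then show thesis
  proof cases
    case 1
    then show ?thesis using that[of g] in_U unfolding deadend_free_def by blast
  next
    case (2 w)
    then obtain h where "prefix g h" "w \<in> ap a (tjoin Z (seg_graph h))" unfolding U_def by auto
    then show ?thesis using that[of h] 2(2) decided unfolding deadend_free_def by blast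
  next
    case (3 w)
    then obtain h where "prefix g h" "w \<in> ap a (tjoin Z (seg_graph h))" unfolding U_def by auto
    then show ?thesis using that[of h] 3(2) decided in_U unfolding deadend_free_def by blast
  qed
qed

lemma nth_prefix: "prefix s t \<Longrightarrow> i < length s \<Longrightarrow> t ! i = s ! i"
  by (auto simp: prefix_def nth_append)

text \<open>Finite extension with two tasks at stage \<open>j\<close>: spoil the operator with index
  \<open>j\<close>, then append a value at least as large as those of the first \<open>j + 1\<close>
  functions. The family \<open>p\<close> is arbitrary, with no effectiveness required.\<close>

lemma Cohen_extension:
  fixes p :: "nat \<Rightarrow> nat \<Rightarrow> nat"
  assumes "avoids P Z"
  shows "\<exists>f. avoids P (tjoin Z (char_graph (fun_graph f))) \<and> (\<forall>i. infinite {n. p i n \<le> f n})"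
proof -
  define Q where "Q j g g' \<longleftrightarrow> prefix g g' \<and>
    (\<forall>f. g' = map f [0..<length g'] \<longrightarrow>
       \<not> deadend_free P (ap (from_nat j) (tjoin Z (char_graph (fun_graph f))))) \<and>
    (\<exists>n\<ge>length g. n < length g' \<and> (\<forall>i\<le>j. p i n \<le> g' ! n))" for j g g'
  have "\<exists>g'. Q j g g'" for j g
  proof -
    obtain h where h: "prefix g h" "\<And>f. h = map f [0..<length h] \<Longrightarrow>
        \<not> deadend_free P (ap (from_nat j) (tjoin Z (char_graph (fun_graph f))))"
      using Cohen_step[OF assms] by blast
    let ?g' = "h @ [Max ((\<lambda>i. p i (length h)) ` {..j})]"
    have "h = map f [0..<length h]" if "?g' = map f [0..<length ?g']" for f
      using that by simp
    moreover have "\<forall>i\<le>j. p i (length h) \<le> ?g' ! length h" by auto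
    moreover have "length g \<le> length h" using h(1) by (rule prefix_length_le)
    ultimately have "Q j g ?g'" unfolding Q_def using h by auto
    then show ?thesis by blast
  qed
  then obtain g where g: "\<And>j. Q j (g j) (g (Suc j))"
    using dependent_nat_choice[of "\<lambda>_ _. True" Q] by auto
  have prefix_Suc: "prefix (g j) (g (Suc j))" and grows: "length (g j) < length (g (Suc j))" for j
    using g[of j] unfolding Q_def by auto
  have prefix_g: "prefix (g j) (g k)" if "j \<le> k" for j k
    using that by (induction rule: dec_induct) (use prefix_Suc prefix_order.trans in blast)+
  have long: "j \<le> length (g j)" for j
    by (induction j) (use grows in \<open>auto simp: Suc_le_eq intro: le_less_trans\<close>)
  \<comment> \<open>Stage \<open>Suc n\<close> has length greater than \<open>n\<close>, so the
    entry exists; later stages do not change it.\<close>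
  define f where "f n = g (Suc n) ! n" for n
  have g_f: "g j ! n = f n" if "n < length (g j)" for j n
    using that long[of "Suc n"] nth_prefix[OF prefix_g] unfolding f_def
    by (metis Suc_le_lessD nle_le)
  have g_eq: "g j = map f [0..<length (g j)]" for j
    by (rule nth_equalityI) (simp_all add: g_f)
  show ?thesis
  proof (intro exI conjI allI)
    show "avoids P (tjoin Z (char_graph (fun_graph f)))"
      unfolding avoids_def
    proof
      fix a :: code
      show "\<not> deadend_free P (ap a (tjoin Z (char_graph (fun_graph f))))"
        using g[of "to_nat a"] g_eq unfolding Q_def by (metis from_nat_to_nat)
    qed
    show "infinite {n. p i n \<le> f n}" for i
      unfolding infinite_nat_iff_unbounded_le
    proof
      fix m
      \<comment> \<open>At stage \<open>max i m\<close> the function \<open>p i\<close> is among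
        those bounded, and the position used is at least \<open>m\<close>.\<close>
      obtain n where n: "n \<ge> length (g (max i m))" "n < length (g (Suc (max i m)))"
        "p i n \<le> g (Suc (max i m)) ! n"
        using g[of "max i m"] unfolding Q_def by auto
      then show "\<exists>n\<ge>m. n \<in> {n. p i n \<le> f n}"
        using long[of "max i m"] g_f[OF n(2)] by (intro exI[of _ n]) auto
    qed
  qed
qed

section \<open>Binary trees\<close>

lemma bcode_eq_iff [simp]: "bcode s = bcode t \<longleftrightarrow> s = t"
proof (induction s arbitrary: t)
  case Nil
  then show ?case by (cases t) auto
next
  case (Cons b s)
  have "2 * bcode s + (if b then 2 else 1) = 2 * bcode u + (if c then 2 else 1) \<longleftrightarrow> b = c \<and> s = u"
    for c u using Cons.IH[of u] by (cases b; cases c; simp; presburger)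
  then show ?case by (cases t) auto
qed

lemma bcode_surj: "\<exists>s. bcode s = n"
proof (induction n rule: less_induct)
  case (less n)
  show ?case
  proof (cases "n = 0")
    case True
    then show ?thesis by (metis bcode.simps(1))
  next
    case False
    then have "(n - 1) div 2 < n" by simp
    then obtain s where s: "bcode s = (n - 1) div 2" using less by blast
    \<comment> \<open>Bijective base two with digits 1 and 2: \<open>True\<close> stands for 2, so
      the head is \<open>True\<close> exactly for even \<open>n\<close>.\<close>
    have "bcode (even n # s) = n" using False unfolding bcode.simps s
      by (cases "even n") (auto elim!: evenE oddE)
    then show ?thesis by blast
  qed
qed

lemma bcode_image_mem [simp]: "bcode \<sigma> \<in> bcode ` T \<longleftrightarrow> \<sigma> \<in> T"
  by (auto simp: image_iff)

lemma is_tree_prefix: "is_tree T \<Longrightarrow> \<tau> \<in> T \<Longrightarrow> prefix \<sigma> \<tau> \<Longrightarrow> \<sigma> \<in> T"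
  unfolding is_tree_def by blast

lemma is_tree_take: "is_tree T \<Longrightarrow> \<tau> \<in> T \<Longrightarrow> take n \<tau> \<in> T"
  using is_tree_prefix take_is_prefix by blast

lemma prefix_eq_take: "prefix \<sigma> \<tau> \<Longrightarrow> \<sigma> = take (length \<sigma>) \<tau>"
  by (auto simp: prefix_def)

lemma finite_length_le: "finite {\<tau> :: bool list. length \<tau> \<le> m}"
  using finite_lists_length_le[of "UNIV :: bool set" m] by simp

text \<open>Each level has finitely many nodes, so an infinite cone contains arbitrarily long nodes,
  and initial segments of these meet every level in between.\<close>

lemma Ext_iff:
  assumes "is_tree T"
  shows "\<sigma> \<in> Ext T \<longleftrightarrow> (\<forall>m\<ge>length \<sigma>. \<exists>\<tau>\<in>T. length \<tau> = m \<and> prefix \<sigma> \<tau>)" (is "_ \<longleftrightarrow> ?R")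
proof
  assume "\<sigma> \<in> Ext T"
  then have inf: "infinite {\<tau> \<in> T. prefix \<sigma> \<tau>}" unfolding Ext_def by simp
  show ?R
  proof (intro allI impI)
    fix m assume m: "length \<sigma> \<le> m"
    have "\<not> {\<tau> \<in> T. prefix \<sigma> \<tau>} \<subseteq> {\<tau>. length \<tau> \<le> m}"
      using inf finite_length_le finite_subset by blast
    then obtain \<tau> where \<tau>: "\<tau> \<in> T" "prefix \<sigma> \<tau>" "m < length \<tau>" by force
    then have "take m \<tau> \<in> T" "length (take m \<tau>) = m" "prefix \<sigma> (take m \<tau>)"
      using assms m prefix_eq_take[OF \<tau>(2)] is_tree_take
      by (auto, metis min.absorb1 take_is_prefix take_take)
    then show "\<exists>\<tau>\<in>T. length \<tau> = m \<and> prefix \<sigma> \<tau>" by blast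
  qed
next
  assume R: ?R
  have "\<sigma> \<in> T" using R[rule_format, of "length \<sigma>"] assms is_tree_prefix by blast
  moreover have "infinite {\<tau> \<in> T. prefix \<sigma> \<tau>}"
  proof
    assume "finite {\<tau> \<in> T. prefix \<sigma> \<tau>}"
    then have "finite (length ` {\<tau> \<in> T. prefix \<sigma> \<tau>})" by blast
    then obtain m where m: "\<And>k. k \<in> length ` {\<tau> \<in> T. prefix \<sigma> \<tau>} \<Longrightarrow> k < m"
      by (metis finite_nat_set_iff_bounded)
    then show False using R[rule_format, of "max m (length \<sigma>)"] by fastforce
  qed
  ultimately show "\<sigma> \<in> Ext T" unfolding Ext_def by simp
qed

lemma Ext_subset: "Ext T \<subseteq> T"
  unfolding Ext_def by blast

lemma Ext_prefix:
  assumes "is_tree T" "\<tau> \<in> Ext T" "prefix \<sigma> \<tau>"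
  shows "\<sigma> \<in> Ext T"
proof -
  have "{\<upsilon> \<in> T. prefix \<tau> \<upsilon>} \<subseteq> {\<upsilon> \<in> T. prefix \<sigma> \<upsilon>}" using assms(3) prefix_order.trans by blast
  then show ?thesis using assms is_tree_prefix finite_subset unfolding Ext_def by blast
qed

lemma Nil_in_Ext: "is_tree T \<Longrightarrow> infinite T \<Longrightarrow> [] \<in> Ext T"
  unfolding Ext_def using is_tree_prefix[of T] by (simp, metis Nil_prefix ex_in_conv finite.emptyI)

text \<open>Compactness: each non-extendible string of length \<open>k\<close> has no extensions in
  the tree from some level on, and there are finitely many such strings, so one level
  \<open>M\<close> works for all.\<close>

lemma take_mem_Ext_of_long:
  assumes T: "is_tree T"
  obtains M where "k \<le> M" "\<And>\<tau>. \<tau> \<in> T \<Longrightarrow> M \<le> length \<tau> \<Longrightarrow> take k \<tau> \<in> Ext T"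
proof -
  have "\<exists>m\<ge>k. \<forall>\<tau>\<in>T. m \<le> length \<tau> \<longrightarrow> \<not> prefix \<rho> \<tau>" if "length \<rho> = k" "\<rho> \<notin> Ext T" for \<rho>
  proof -
    have "\<not> (\<forall>m\<ge>k. \<exists>\<tau>\<in>T. length \<tau> = m \<and> prefix \<rho> \<tau>)"
      using that Ext_iff[OF T, of \<rho>] by simp
    then obtain m where m: "m \<ge> k" "\<not> (\<exists>\<tau>\<in>T. length \<tau> = m \<and> prefix \<rho> \<tau>)"
      by blast
    have "\<not> prefix \<rho> \<tau>" if "\<tau> \<in> T" "m \<le> length \<tau>" for \<tau>
    proof
      assume "prefix \<rho> \<tau>"
      then have "prefix \<rho> (take m \<tau>)"
        using that(2) m(1) \<open>length \<rho> = k\<close> prefix_length_prefix take_is_prefix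
        by (metis length_take min.absorb2)
      then show False using m(2) is_tree_take[OF T that(1), of m] that(2) by auto
    qed
    then show ?thesis using m(1) by blast
  qed
  then obtain m where m: "\<And>\<rho>. length \<rho> = k \<Longrightarrow> \<rho> \<notin> Ext T \<Longrightarrow>
      k \<le> m \<rho> \<and> (\<forall>\<tau>\<in>T. m \<rho> \<le> length \<tau> \<longrightarrow> \<not> prefix \<rho> \<tau>)" by metis
  define M where "M = Max (insert k (m ` {\<rho>. length \<rho> = k}))"
  have fin: "finite (insert k (m ` {\<rho>. length \<rho> = k}))" using finite_bool_lists_length_eq by simp
  show thesis
  proof
    show "k \<le> M" unfolding M_def using fin by (rule Max_ge) simp
    fix \<tau> assume \<tau>: "\<tau> \<in> T" "M \<le> length \<tau>"
    have len: "length (take k \<tau>) = k" using \<tau>(2) \<open>k \<le> M\<close> by simp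
    then have "m (take k \<tau>) \<le> M" unfolding M_def using fin by (intro Max_ge) auto
    then show "take k \<tau> \<in> Ext T" using m[OF len] \<tau> take_is_prefix le_trans by blast
  qed
qed

lemma Ext_snoc:
  assumes T: "is_tree T" and \<sigma>: "\<sigma> \<in> Ext T"
  obtains b where "\<sigma> @ [b] \<in> Ext T"
proof -
  obtain M where M: "Suc (length \<sigma>) \<le> M"
    "\<And>\<tau>. \<tau> \<in> T \<Longrightarrow> M \<le> length \<tau> \<Longrightarrow> take (Suc (length \<sigma>)) \<tau> \<in> Ext T"
    using take_mem_Ext_of_long[OF T] by blast
  have "length \<sigma> \<le> M" using M(1) by simp
  then obtain \<tau> where \<tau>: "\<tau> \<in> T" "length \<tau> = M" "prefix \<sigma> \<tau>" using Ext_iff[OF T] \<sigma> by metis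
  then have "take (Suc (length \<sigma>)) \<tau> = \<sigma> @ [\<tau> ! length \<sigma>]"
    using M(1) prefix_eq_take[OF \<tau>(3)] by (simp add: take_Suc_conv_app_nth)
  then show thesis using that M(2)[of \<tau>] \<tau> by simp
qed

lemma Ext_extension:
  assumes T: "is_tree T" and \<sigma>: "\<sigma> \<in> Ext T" and "length \<sigma> \<le> m"
  shows "\<exists>\<tau>\<in>Ext T. length \<tau> = m \<and> prefix \<sigma> \<tau>"
  using assms(3)
proof (induction m rule: dec_induct)
  case base
  then show ?case using \<sigma> by blast
next
  case (step m)
  then obtain \<tau> where "\<tau> \<in> Ext T" "length \<tau> = m" "prefix \<sigma> \<tau>" by blast
  moreover then obtain b where "\<tau> @ [b] \<in> Ext T" using Ext_snoc[OF T] by blast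
  ultimately show ?case by (intro bexI[of _ "\<tau> @ [b]"]) auto
qed

text \<open>Past all branching levels, \<open>\<sigma>\<close> has one extendible continuation at
  each level. Its bits are found by waiting: non-extendible competitors leave the tree by some
  level, and then all remaining nodes above \<open>\<sigma>\<close> agree on the bit.\<close>

lemma path_op_isolated_path:
  assumes T: "is_tree T" and \<sigma>: "\<sigma> \<in> Ext T" and no_Br: "\<And>\<tau>. \<tau> \<in> Br T \<Longrightarrow> length \<tau> < length \<sigma>"
  obtains p where "is_path T p" "path_op \<sigma> (char_graph (bcode ` T)) = char_graph {n. p n}"
proof -
  have unique: "\<tau> = \<tau>'" if "\<tau> \<in> Ext T" "\<tau>' \<in> Ext T" "prefix \<sigma> \<tau>" "prefix \<sigma> \<tau>'"
    "length \<tau> = length \<tau>'" for \<tau> \<tau>'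
  proof (rule ccontr)
    assume "\<tau> \<noteq> \<tau>'"
    then have "\<not> prefix \<tau> \<tau>'" "\<not> prefix \<tau>' \<tau>"
      using that(5) by (auto simp: prefix_def)
    then have "parallel \<tau> \<tau>'" by blast
    \<comment> \<open>At the first disagreement both children are extendible, which makes
      \<open>\<rho>\<close> a branching node. Hence it is shorter than \<open>\<sigma>\<close>, and
      at that position both strings copy \<open>\<sigma>\<close>.\<close>
    then obtain \<rho> b bs c cs where \<rho>: "b \<noteq> c" "\<tau> = \<rho> @ b # bs" "\<tau>' = \<rho> @ c # cs"
      using parallel_decomp[OF \<open>parallel \<tau> \<tau>'\<close>] by metis
    then have "prefix (\<rho> @ [b]) \<tau>" "prefix (\<rho> @ [c]) \<tau>'" by simp_all
    then have "\<rho> @ [b] \<in> Ext T" "\<rho> @ [c] \<in> Ext T" using that Ext_prefix[OF T] by blast+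
    then have "\<rho> @ [False] \<in> Ext T \<and> \<rho> @ [True] \<in> Ext T"
      using \<rho>(1) by (cases b; cases c) auto
    moreover then have "\<rho> \<in> T" using Ext_subset Ext_prefix[OF T] by (metis prefixI subsetD)
    ultimately have "length \<rho> < length \<sigma>" using no_Br unfolding Br_def by blast
    then have "\<tau> ! length \<rho> = \<sigma> ! length \<rho>" "\<tau>' ! length \<rho> = \<sigma> ! length \<rho>"
      using that(3,4) by (auto simp: prefix_def nth_append)
    then show False using \<rho> by simp
  qed
  have "\<forall>m. length \<sigma> \<le> m \<longrightarrow> (\<exists>\<tau>. \<tau> \<in> Ext T \<and> length \<tau> = m \<and> prefix \<sigma> \<tau>)"
    using Ext_extension[OF T \<sigma>] by blast
  then obtain u where u: "\<And>m. length \<sigma> \<le> m \<Longrightarrow> u m \<in> Ext T \<and> length (u m) = m \<and> prefix \<sigma> (u m)"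
    by metis
  have u_take: "take k (u m) = u k" if "length \<sigma> \<le> k" "k \<le> m" for k m
  proof (rule unique)
    have m: "length \<sigma> \<le> m" using that by simp
    show "take k (u m) \<in> Ext T" using u[OF m] Ext_prefix[OF T] take_is_prefix by blast
    show "prefix \<sigma> (take k (u m))"
      using u[OF m] that prefix_length_prefix take_is_prefix by (metis length_take min.absorb2)
  qed (use u that in auto)
  \<comment> \<open>The sequence \<open>u\<close> is constrained only from level
    \<open>length \<sigma>\<close> on, whence the maximum.\<close>
  define p where "p n = u (max (length \<sigma>) (Suc n)) ! n" for n
  have p_u: "u m ! n = p n" if "length \<sigma> \<le> m" "n < m" for m n
  proof -
    have "take (max (length \<sigma>) (Suc n)) (u m) = u (max (length \<sigma>) (Suc n))"
      using that by (intro u_take) auto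
    then show ?thesis unfolding p_def using nth_take[of n "max (length \<sigma>) (Suc n)" "u m"] by simp
  qed
  show thesis
  proof
    show "is_path T p" unfolding is_path_def
    proof
      fix n
      have m: "length \<sigma> \<le> max (length \<sigma>) n" by simp
      have "map p [0..<n] = take n (u (max (length \<sigma>) n))"
        using u[OF m] p_u[OF m] by (intro nth_equalityI) auto
      then show "map p [0..<n] \<in> T" using u[OF m] Ext_subset is_tree_take[OF T] by (metis subsetD)
    qed
    show "path_op \<sigma> (char_graph (bcode ` T)) = char_graph {n. p n}"
    proof (rule char_graph_eqI)
      fix n b
      have "2 * n + of_bool b \<in> path_op \<sigma> (char_graph (bcode ` T)) \<longleftrightarrow>
          (\<exists>m\<ge>length \<sigma>. n < m \<and> (\<forall>\<tau>\<in>T. length \<tau> = m \<and> prefix \<sigma> \<tau> \<longrightarrow> \<tau> ! n = b))"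
        unfolding path_op_def mem_Collect_eq double_of_bool_eq_iff char_graph_mem0 bcode_image_mem
        by blast
      also have "\<dots> \<longleftrightarrow> p n = b"
      proof
        assume "\<exists>m\<ge>length \<sigma>. n < m \<and> (\<forall>\<tau>\<in>T. length \<tau> = m \<and> prefix \<sigma> \<tau> \<longrightarrow> \<tau> ! n = b)"
        then show "p n = b" using u p_u Ext_subset by (metis subsetD)
      next
        assume b: "p n = b"
        define k where "k = max (length \<sigma>) (Suc n)"
        have k: "length \<sigma> \<le> k" "n < k" unfolding k_def by auto
        obtain M where M: "k \<le> M" "\<And>\<tau>. \<tau> \<in> T \<Longrightarrow> M \<le> length \<tau> \<Longrightarrow> take k \<tau> \<in> Ext T"
          using take_mem_Ext_of_long[OF T] by blast
        have "\<tau> ! n = b" if \<tau>: "\<tau> \<in> T" "length \<tau> = M" "prefix \<sigma> \<tau>" for \<tau>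
        proof -
          have "prefix \<sigma> (take k \<tau>)"
            using \<tau> M(1) k(1) prefix_length_prefix take_is_prefix by (metis length_take min.absorb2)
          then have "take k \<tau> = u k" using M \<tau> k(1) u[OF k(1)] by (intro unique) auto
          then show ?thesis using p_u[OF k] b k(2) by (metis nth_take)
        qed
        then show "\<exists>m\<ge>length \<sigma>. n < m \<and> (\<forall>\<tau>\<in>T. length \<tau> = m \<and> prefix \<sigma> \<tau> \<longrightarrow> \<tau> ! n = b)"
          using M(1) k le_trans less_le_trans by blast
      qed
      finally show "2 * n + of_bool b \<in> path_op \<sigma> (char_graph (bcode ` T)) \<longleftrightarrow> (b \<longleftrightarrow> n \<in> {n. p n})"
        by auto
    qed
  qed
qed

section \<open>The tree\<close>

text \<open>Segments of a path, with entries other than 1 read as \<open>False\<close>, or segments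
  of a bound as in DIM. One set for both lets a single step of the construction defeat paths and
  bounds.\<close>

definition witness_segs :: "bool list set \<Rightarrow> nat list set" where
  "witness_segs T = {s. map (\<lambda>x. x = 1) s \<in> Ext T \<or>
     (\<forall>i<length s. \<forall>\<sigma>\<in>Ext T. length \<sigma> = i \<longrightarrow> (\<exists>\<tau>\<in>Br T. prefix \<sigma> \<tau> \<and> length \<tau> \<le> s ! i))}"

text \<open>Determined by the levels up to \<open>n\<close>, so an output obtained from it persists
  in every tree with the same lower levels.\<close>

definition tree_graph :: "bool list set \<Rightarrow> nat \<Rightarrow> nat set" where
  "tree_graph F n = {2 * bcode \<sigma> + of_bool (\<sigma> \<in> F) | \<sigma>. length \<sigma> \<le> n}"

text \<open>
  A condition is a tree together with a level \<open>n\<close>, with the promise that every node of that level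
  will be extendible.
\<close>

definition pure_ext :: "nat \<Rightarrow> bool list set \<Rightarrow> nat \<Rightarrow> bool list set \<Rightarrow> bool" where
  "pure_ext n F n' F' \<longleftrightarrow> n \<le> n' \<and> (\<forall>\<sigma>. length \<sigma> \<le> n \<longrightarrow> (\<sigma> \<in> F' \<longleftrightarrow> \<sigma> \<in> F)) \<and>
     (\<forall>\<sigma>\<in>F. length \<sigma> = n \<longrightarrow> (\<exists>\<tau>\<in>F'. length \<tau> = n' \<and> prefix \<sigma> \<tau>))"

definition pure_limit :: "nat \<Rightarrow> bool list set \<Rightarrow> bool list set \<Rightarrow> bool" where
  "pure_limit n F T \<longleftrightarrow> is_tree T \<and> (\<forall>m\<ge>n. pure_ext n F m T)"

lemma pure_ext_trans:
  assumes 1: "pure_ext n F n' F'" and 2: "pure_ext n' F' n'' F''"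
  shows "pure_ext n F n'' F''"
  unfolding pure_ext_def
proof (intro conjI allI impI ballI)
  show "n \<le> n''" using assms unfolding pure_ext_def by linarith
  show "\<sigma> \<in> F'' \<longleftrightarrow> \<sigma> \<in> F" if "length \<sigma> \<le> n" for \<sigma>
    using assms that unfolding pure_ext_def by (meson le_trans)
  fix \<sigma> assume \<sigma>: "\<sigma> \<in> F" "length \<sigma> = n"
  then obtain \<tau> where \<tau>: "\<tau> \<in> F'" "length \<tau> = n'" "prefix \<sigma> \<tau>"
    using 1 unfolding pure_ext_def by blast
  then obtain \<upsilon> where "\<upsilon> \<in> F''" "length \<upsilon> = n''" "prefix \<tau> \<upsilon>"
    using 2 unfolding pure_ext_def by blast
  then show "\<exists>\<tau>\<in>F''. length \<tau> = n'' \<and> prefix \<sigma> \<tau>"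
    using \<tau>(3) prefix_order.trans by blast
qed

lemma pure_limit_Ext:
  assumes "pure_limit n F T" "\<sigma> \<in> F" "length \<sigma> = n"
  shows "\<sigma> \<in> Ext T"
  using assms Ext_iff unfolding pure_limit_def pure_ext_def by simp

lemma tree_graph_mono:
  assumes "n \<le> m" "\<And>\<sigma>. length \<sigma> \<le> n \<Longrightarrow> \<sigma> \<in> G \<longleftrightarrow> \<sigma> \<in> F"
  shows "tree_graph F n \<subseteq> tree_graph G m"
proof
  fix z assume "z \<in> tree_graph F n"
  then obtain \<sigma> where \<sigma>: "z = 2 * bcode \<sigma> + of_bool (\<sigma> \<in> F)" "length \<sigma> \<le> n"
    unfolding tree_graph_def by blast
  then have "z = 2 * bcode \<sigma> + of_bool (\<sigma> \<in> G)" "length \<sigma> \<le> m" using assms by simp_all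
  then show "z \<in> tree_graph G m" unfolding tree_graph_def by blast
qed

lemma tree_graph_subset: "tree_graph T n \<subseteq> char_graph (bcode ` T)"
  unfolding tree_graph_def by (auto simp only: in_char_graph_iff bcode_image_mem)

lemma ap_tree_graph:
  assumes "w \<in> ap a (char_graph (bcode ` T))"
  obtains m where "m \<ge> n" "w \<in> ap a (tree_graph T m)"
proof (rule finitary_directed_Union[OF finitary_ap assms])
  show "char_graph (bcode ` T) \<subseteq> (\<Union>n. tree_graph T n)"
  proof
    fix z assume "z \<in> char_graph (bcode ` T)"
    then obtain x where x: "z = 2 * x + of_bool (x \<in> bcode ` T)" unfolding char_graph_def by blast
    obtain \<sigma> where "x = bcode \<sigma>" using bcode_surj by metis
    then have "z \<in> tree_graph T (length \<sigma>)" unfolding tree_graph_def x by auto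
    then show "z \<in> (\<Union>n. tree_graph T n)" by blast
  qed
  show "mono (\<lambda>n. tree_graph T n)" by (rule monoI) (simp add: tree_graph_mono)
qed (use that in blast)

lemma deadend_free_long:
  assumes "deadend_free P W"
  obtains w where "w \<in> W" "k \<le> length (list_decode w)"
proof -
  have "\<exists>w\<in>W. k \<le> length (list_decode w)"
  proof (induction k)
    case 0
    then show ?case using assms unfolding deadend_free_def by auto
  next
    case (Suc k)
    then obtain w where w: "w \<in> W" "k \<le> length (list_decode w)" by blast
    then obtain v where "v \<in> W" "strict_prefix (list_decode w) (list_decode v)"
      using assms unfolding deadend_free_def by blast
    then show ?case using w(2) prefix_length_less by (metis Suc_leI le_less_trans)
  qed
  then show thesis using that by blast
qed

text \<open>Each node of level \<open>n\<close> is first split, giving \<open>F1\<close>. If no pure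
  extension of \<open>F1\<close> makes the operator output a sequence of length at least
  \<open>n + 2\<close>, outputs stay too short to be free of dead ends. Otherwise one such sequence
  \<open>s\<close> is spoiled: its first \<open>n + 1\<close> entries, read as bits, name a node
  that is made to die, and the surviving chains do not branch from level \<open>n + 1\<close> until
  past the bound that entry \<open>n + 1\<close> proposes for that level.\<close>

lemma tree_step:
  assumes F: "is_tree F" and level: "\<exists>\<sigma>\<in>F. length \<sigma> = n"
  obtains n2 F2 where "n < n2" "is_tree F2" "pure_ext n F n2 F2"
    "\<And>T. pure_limit n2 F2 T \<Longrightarrow> \<not> deadend_free (witness_segs T) (ap a (char_graph (bcode ` T)))"
proof -
  define F1 where "F1 = {\<sigma> \<in> F. length \<sigma> \<le> n} \<union> {\<sigma> @ [b] | \<sigma> b. \<sigma> \<in> F \<and> length \<sigma> = n}"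
  have "is_tree F1" unfolding is_tree_def
  proof (intro ballI allI impI)
    fix \<tau> \<sigma> assume \<tau>: "\<tau> \<in> F1" "prefix \<sigma> \<tau>"
    then consider "\<tau> \<in> F" "length \<tau> \<le> n" | \<rho> b where "\<tau> = \<rho> @ [b]" "\<rho> \<in> F" "length \<rho> = n"
      unfolding F1_def by blast
    then show "\<sigma> \<in> F1"
    proof cases
      case 1
      then show ?thesis
        using \<tau>(2) is_tree_prefix[OF F] prefix_length_le[OF \<tau>(2)] unfolding F1_def by auto
    next
      case 2
      then have "\<sigma> = \<tau> \<or> prefix \<sigma> \<rho>" using \<tau>(2) by simp
      then show ?thesis
        using 2 \<tau>(1) is_tree_prefix[OF F] prefix_length_le[of \<sigma> \<rho>] unfolding F1_def by auto
    qed
  qed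
  have F1: "pure_ext n F (Suc n) F1"
    unfolding pure_ext_def
  proof (intro conjI allI impI ballI)
    fix \<sigma> assume "\<sigma> \<in> F" "length \<sigma> = n"
    then show "\<exists>\<tau>\<in>F1. length \<tau> = Suc n \<and> prefix \<sigma> \<tau>"
      unfolding F1_def by (intro bexI[of _ "\<sigma> @ [True]"]) auto
  qed (auto simp: F1_def)
  show thesis
  proof (cases "\<exists>n' F' w. pure_ext (Suc n) F1 n' F' \<and> is_tree F' \<and> w \<in> ap a (tree_graph F' n') \<and>
      n + 2 \<le> length (list_decode w)")
    case False
    show ?thesis
    proof (rule that[of "Suc n" F1])
      fix T assume T: "pure_limit (Suc n) F1 T"
      show "\<not> deadend_free (witness_segs T) (ap a (char_graph (bcode ` T)))"
      proof
        assume "deadend_free (witness_segs T) (ap a (char_graph (bcode ` T)))"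
        then obtain w where w: "w \<in> ap a (char_graph (bcode ` T))" "n + 2 \<le> length (list_decode w)"
          using deadend_free_long by blast
        obtain m where "m \<ge> Suc n" "w \<in> ap a (tree_graph T m)" using ap_tree_graph[OF w(1)] by blast
        then show False using False T w(2) unfolding pure_limit_def by blast
      qed
    qed (use \<open>is_tree F1\<close> F1 in auto)
  next
    case True
    then obtain n' F' w where F': "pure_ext (Suc n) F1 n' F'" "is_tree F'"
      and w: "w \<in> ap a (tree_graph F' n')" "n + 2 \<le> length (list_decode w)" by blast
    have n': "Suc n \<le> n'" using F'(1) unfolding pure_ext_def by simp
    define s where "s = list_decode w"
    define r where "r = map (\<lambda>x. x = 1) (take (Suc n) s)"
    have "length r = Suc n" unfolding r_def using w(2) by (simp add: s_def)
    have "\<exists>t\<in>F'. length t = n' \<and> prefix x t \<and> take (Suc n) t \<noteq> r" if x: "x \<in> F" "length x = n" for x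
    proof -
      \<comment> \<open>Here the splitting pays off: one child of \<open>x\<close> differs from
        \<open>r\<close> in its last bit, and the promise for level \<open>Suc n\<close> extends
        that child to level \<open>n'\<close>.\<close>
      have "x @ [\<not> r ! n] \<in> F1" "length (x @ [\<not> r ! n]) = Suc n" unfolding F1_def using x by auto
      then obtain t where t: "t \<in> F'" "length t = n'" "prefix (x @ [\<not> r ! n]) t"
        using F'(1) unfolding pure_ext_def by blast
      have "take (Suc n) t = x @ [\<not> r ! n]" using prefix_eq_take[OF t(3)] x(2) by simp
      then have "take (Suc n) t \<noteq> r" using x(2) by (metis nth_append_length)
      then show ?thesis using t append_prefixD by blast
    qed
    then obtain t where t: "\<And>x. x \<in> F \<Longrightarrow> length x = n \<Longrightarrow>
        t x \<in> F' \<and> length (t x) = n' \<and> prefix x (t x) \<and> take (Suc n) (t x) \<noteq> r"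
      by metis
    \<comment> \<open>The successor leaves room for the children of a node of length up to
      \<open>s ! Suc n\<close>, which thus still lie at or below level \<open>N\<close>.\<close>
    define N where "N = Suc (max n' (s ! Suc n))"
    define u where "u x j = t x @ replicate j False" for x j
    \<comment> \<open>Keeping \<open>F'\<close> up to level \<open>n'\<close> preserves the output
      \<open>w\<close>; beyond it only one chain of zeros above each chosen \<open>t x\<close>
      survives.\<close>
    define F2 where "F2 = {\<sigma> \<in> F'. length \<sigma> \<le> n'} \<union>
        {u x j | x j. x \<in> F \<and> length x = n \<and> n' + j \<le> N}"
    have N: "n' < N" "s ! Suc n < N" "n < N" unfolding N_def using n' by auto
    have F2_low: "\<sigma> \<in> F2 \<longleftrightarrow> \<sigma> \<in> F'" if "length \<sigma> \<le> n'" for \<sigma>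
      using that t unfolding F2_def u_def by auto
    have F2_low': "\<sigma> \<in> F2 \<longleftrightarrow> \<sigma> \<in> F" if "length \<sigma> \<le> n" for \<sigma>
    proof -
      have "\<sigma> \<in> F2 \<longleftrightarrow> \<sigma> \<in> F1"
        using F2_low that n' F'(1) unfolding pure_ext_def by simp
      then show ?thesis using F1 that unfolding pure_ext_def by simp
    qed
    have F2_top: "\<exists>x. x \<in> F \<and> length x = n \<and> \<sigma> = u x (N - n')" if \<sigma>: "\<sigma> \<in> F2" "length \<sigma> = N" for \<sigma>
    proof -
      obtain x j where "x \<in> F" "length x = n" "\<sigma> = u x j" "n' + j \<le> N"
        using \<sigma> N(1) unfolding F2_def by auto
      moreover then have "j = N - n'" using \<sigma>(2) t unfolding u_def by auto
      ultimately show ?thesis by blast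
    qed
    have u_top: "u x (N - n') \<in> F2" "length (u x (N - n')) = N" "prefix x (u x (N - n'))"
      "take n (u x (N - n')) = x" "take (Suc n) (u x (N - n')) = take (Suc n) (t x)"
      if x: "x \<in> F" "length x = n" for x
    proof -
      have "n' + (N - n') \<le> N" using N(1) by simp
      then show "u x (N - n') \<in> F2" unfolding F2_def using x by blast
      show "length (u x (N - n')) = N" using t[OF x] N(1) unfolding u_def by simp
      show p: "prefix x (u x (N - n'))" using t[OF x] unfolding u_def by simp
      show "take n (u x (N - n')) = x" using prefix_eq_take[OF p] x(2) by simp
      show "take (Suc n) (u x (N - n')) = take (Suc n) (t x)"
        using t[OF x] n' unfolding u_def by simp
    qed
    show ?thesis
    proof (rule that[of N F2])
      show "is_tree F2" unfolding is_tree_def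
      proof (intro ballI allI impI)
        fix \<tau> \<sigma> assume \<tau>: "\<tau> \<in> F2" "prefix \<sigma> \<tau>"
        show "\<sigma> \<in> F2"
        proof (cases "length \<tau> \<le> n'")
          case True
          moreover have "length \<sigma> \<le> length \<tau>" using \<tau>(2) by (rule prefix_length_le)
          ultimately show ?thesis using F2_low \<tau> is_tree_prefix[OF F'(2)] by (meson le_trans)
        next
          case False
          then obtain x j where x: "x \<in> F" "length x = n" "n' + j \<le> N" and j: "\<tau> = u x j"
            using \<tau>(1) unfolding F2_def by auto
          have \<sigma>: "\<sigma> = take (length \<sigma>) (t x) @ replicate (min (length \<sigma> - n') j) False"
            using prefix_eq_take[OF \<tau>(2)] t[OF x(1,2)] unfolding j u_def by simp
          show ?thesis
          proof (cases "length \<sigma> \<le> n'")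
            case True
            then have "\<sigma> \<in> F'" using \<sigma> is_tree_take[OF F'(2)] t[OF x(1,2)]
              by (metis append_Nil2 diff_is_0_eq min_0L replicate_0)
            then show ?thesis using F2_low True by blast
          next
            case False
            then have "\<sigma> = u x (min (length \<sigma> - n') j)"
              using \<sigma> t[OF x(1,2)] unfolding u_def by simp
            moreover have "n' + min (length \<sigma> - n') j \<le> N" using x(3) by linarith
            ultimately show ?thesis using x unfolding F2_def by blast
          qed
        qed
      qed
      show "n < N" by (fact N(3))
      show "pure_ext n F N F2"
        unfolding pure_ext_def using F2_low' u_top N(3) less_imp_le by blast
      fix T assume T: "pure_limit N F2 T"
      then have "is_tree T" unfolding pure_limit_def by blast
      have T_F2: "\<sigma> \<in> T \<longleftrightarrow> \<sigma> \<in> F2" if "length \<sigma> \<le> N" for \<sigma>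
        using T that unfolding pure_limit_def pure_ext_def by blast
      have "tree_graph F' n' \<subseteq> char_graph (bcode ` T)"
        using tree_graph_mono[of n' N T F'] tree_graph_subset[of T N] T_F2 F2_low N(1) by force
      then have w_T: "w \<in> ap a (char_graph (bcode ` T))" using w(1) ap_mono by blast
      \<comment> \<open>Extendible nodes up to level \<open>N\<close> lie on the chosen chains,
        since nothing else reaches that level.\<close>
      have Ext_top: "\<exists>x. x \<in> F \<and> length x = n \<and> prefix \<sigma> (u x (N - n'))"
        if \<sigma>: "\<sigma> \<in> Ext T" "length \<sigma> \<le> N" for \<sigma>
      proof -
        obtain \<tau> where "\<tau> \<in> T" "length \<tau> = N" "prefix \<sigma> \<tau>"
          using \<sigma> Ext_iff[OF \<open>is_tree T\<close>] by metis
        then show ?thesis using T_F2[of \<tau>] F2_top[of \<tau>] by auto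
      qed
      have "s \<notin> witness_segs T"
      proof
        assume "s \<in> witness_segs T"
        then consider "map (\<lambda>x. x = 1) s \<in> Ext T"
          | "\<forall>\<sigma>\<in>Ext T. length \<sigma> = Suc n \<longrightarrow> (\<exists>\<tau>\<in>Br T. prefix \<sigma> \<tau> \<and> length \<tau> \<le> s ! Suc n)"
          unfolding witness_segs_def using w(2) by (auto simp: s_def)
        then show False
        proof cases
          case 1
          have "prefix r (map (\<lambda>x. x = 1) s)" unfolding r_def by (simp add: map_mono_prefix take_is_prefix)
          then have "r \<in> Ext T" using 1 Ext_prefix[OF \<open>is_tree T\<close>] by blast
          moreover have "length r \<le> N" using \<open>length r = Suc n\<close> N(3) by simp
          ultimately obtain x where x: "x \<in> F" "length x = n" "prefix r (u x (N - n'))"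
            using Ext_top by blast
          then have "r = take (Suc n) (t x)"
            using prefix_eq_take[OF x(3)] u_top(5)[OF x(1,2)] \<open>length r = Suc n\<close> by simp
          then show False using t[OF x(1,2)] by blast
        next
          case 2
          obtain x where x: "x \<in> F" "length x = n" using level by blast
          define \<sigma> where "\<sigma> = take (Suc n) (t x)"
          have "u x (N - n') \<in> Ext T" using pure_limit_Ext[OF T] u_top[OF x] by blast
          then have "\<sigma> \<in> Ext T" unfolding \<sigma>_def
            using Ext_prefix[OF \<open>is_tree T\<close>] take_is_prefix u_top(5)[OF x] by metis
          moreover have "length \<sigma> = Suc n" unfolding \<sigma>_def using t[OF x] n' by simp
          ultimately obtain \<tau> where \<tau>: "\<tau> \<in> Br T" "prefix \<sigma> \<tau>" "length \<tau> \<le> s ! Suc n"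
            using 2 by blast
          have "Suc n \<le> length \<tau>" using \<tau>(2) \<open>length \<sigma> = Suc n\<close> prefix_length_le by fastforce
          have top: "\<exists>y. y \<in> F \<and> length y = n \<and> prefix (\<tau> @ [b]) (u y (N - n'))" for b
          proof (rule Ext_top)
            show "\<tau> @ [b] \<in> Ext T" using \<tau>(1) unfolding Br_def by (cases b) auto
            show "length (\<tau> @ [b]) \<le> N" using \<tau>(3) N(2) by simp
          qed
          obtain y where y: "y \<in> F" "length y = n" "prefix (\<tau> @ [False]) (u y (N - n'))"
            using top by blast
          obtain z where z: "z \<in> F" "length z = n" "prefix (\<tau> @ [True]) (u z (N - n'))"
            using top by blast
          \<comment> \<open>A chain is determined by its node of level \<open>n\<close>, and both
            chains pass through \<open>\<tau>\<close>; so they coincide and cannot follow both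
            children.\<close>
          have "take n \<tau> = y" "take n \<tau> = z"
            using u_top(4)[OF y(1,2)] u_top(4)[OF z(1,2)] y(3) z(3) \<open>Suc n \<le> length \<tau>\<close>
            by (auto simp: prefix_def)
          then have "y = z" by simp
          then show False using nth_prefix[OF y(3), of "length \<tau>"] nth_prefix[OF z(3), of "length \<tau>"]
            by simp
        qed
      qed
      then show "\<not> deadend_free (witness_segs T) (ap a (char_graph (bcode ` T)))"
        using w_T unfolding deadend_free_def s_def by blast
    qed
  qed
qed

text \<open>Fusion: stage \<open>j\<close> applies \<open>tree_step\<close> to the operator with
  index \<open>j\<close>, and the conditions have a common pure limit.\<close>

lemma generic_tree_exists:
  obtains T where "is_tree T" "infinite T" "avoids (witness_segs T) (char_graph (bcode ` T))"
proof -
  define C where "C c \<longleftrightarrow> is_tree (snd c) \<and> (\<exists>\<sigma>\<in>snd c. length \<sigma> = fst c)"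
    for c :: "nat \<times> bool list set"
  define Q where "Q j c c' \<longleftrightarrow> fst c < fst c' \<and> pure_ext (fst c) (snd c) (fst c') (snd c') \<and>
    (\<forall>T. pure_limit (fst c') (snd c') T \<longrightarrow>
      \<not> deadend_free (witness_segs T) (ap (from_nat j) (char_graph (bcode ` T))))"
    for j c c'
  have "C (0, {[]})" unfolding C_def is_tree_def by auto
  moreover have "\<exists>c'. C c' \<and> Q j c c'" if "C c" for c j
  proof -
    obtain n F where c: "c = (n, F)" by (cases c)
    then have F: "is_tree F" "\<exists>\<sigma>\<in>F. length \<sigma> = n" using that unfolding C_def by auto
    obtain n2 F2 where "n < n2" "is_tree F2" and e: "pure_ext n F n2 F2"
      and "\<And>T. pure_limit n2 F2 T \<Longrightarrow>
        \<not> deadend_free (witness_segs T) (ap (from_nat j) (char_graph (bcode ` T)))"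
      using tree_step[OF F] by blast
    moreover have "\<exists>\<sigma>\<in>F2. length \<sigma> = n2" using F(2) e unfolding pure_ext_def by blast
    ultimately have "C (n2, F2) \<and> Q j c (n2, F2)" unfolding C_def Q_def c by simp
    then show ?thesis by blast
  qed
  ultimately obtain c where c: "\<And>j. C (c j)" "\<And>j. Q j (c j) (c (Suc j))"
    using dependent_nat_choice[of "\<lambda>_. C" Q] by blast
  define n F where "n j = fst (c j)" and "F j = snd (c j)" for j
  have tree: "is_tree (F j)" and level: "\<exists>\<sigma>\<in>F j. length \<sigma> = n j" for j
    using c(1)[of j] unfolding C_def n_def F_def by auto
  have less: "n j < n (Suc j)" and ext_Suc: "pure_ext (n j) (F j) (n (Suc j)) (F (Suc j))" for j
    using c(2)[of j] unfolding Q_def n_def F_def by auto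
  have n_ge: "j \<le> n j" for j
    by (induction j) (use less in \<open>auto simp: Suc_le_eq intro: le_less_trans\<close>)
  have ext: "pure_ext (n j) (F j) (n k) (F k)" if "j \<le> k" for j k
    using that
  proof (induction rule: dec_induct)
    case base
    then show ?case unfolding pure_ext_def by auto
  next
    case (step k)
    then show ?case using ext_Suc pure_ext_trans by blast
  qed
  \<comment> \<open>Stage \<open>length \<sigma>\<close> has settled all nodes of that length,
    because \<open>j \<le> n j\<close>.\<close>
  define T where "T = {\<sigma>. \<sigma> \<in> F (length \<sigma>)}"
  have T_F: "\<sigma> \<in> T \<longleftrightarrow> \<sigma> \<in> F j" if "length \<sigma> \<le> n j" for \<sigma> j
  proof (cases "j \<le> length \<sigma>")
    case True
    then show ?thesis using ext[OF True] that unfolding T_def pure_ext_def by blast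
  next
    case False
    then have "length \<sigma> \<le> j" by simp
    from ext[OF this] show ?thesis using n_ge unfolding T_def pure_ext_def by blast
  qed
  have "is_tree T" unfolding is_tree_def
  proof (intro ballI allI impI)
    fix \<tau> \<sigma> assume \<tau>: "\<tau> \<in> T" "prefix \<sigma> \<tau>"
    then have "\<sigma> \<in> F (length \<tau>)" using tree is_tree_prefix unfolding T_def by blast
    moreover have "length \<sigma> \<le> n (length \<tau>)" using \<tau>(2) n_ge prefix_length_le le_trans by blast
    ultimately show "\<sigma> \<in> T" using T_F by blast
  qed
  have limit: "pure_limit (n j) (F j) T" for j
    unfolding pure_limit_def pure_ext_def
  proof (intro conjI allI impI ballI)
    fix m \<sigma> assume m: "n j \<le> m" and \<sigma>: "\<sigma> \<in> F j" "length \<sigma> = n j"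
    \<comment> \<open>A stage whose level is at least \<open>m\<close> extends
      \<open>\<sigma>\<close>; cutting the extension at \<open>m\<close> gives the witness.\<close>
    define k where "k = max j m"
    have "j \<le> k" unfolding k_def by simp
    then obtain \<tau> where \<tau>: "\<tau> \<in> F k" "length \<tau> = n k" "prefix \<sigma> \<tau>"
      using ext[of j k] \<sigma> unfolding pure_ext_def by blast
    have "m \<le> n k" using n_ge[of k] unfolding k_def by simp
    then have "length (take m \<tau>) = m" using \<tau>(2) by simp
    moreover have "take m \<tau> \<in> T" using T_F[of "take m \<tau>" k] is_tree_take[OF tree \<tau>(1)] \<tau>(2) by simp
    moreover have "prefix \<sigma> (take m \<tau>)"
      using prefix_length_prefix[OF \<tau>(3) take_is_prefix] \<open>length (take m \<tau>) = m\<close> \<sigma>(2) m by simp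
    ultimately show "\<exists>\<tau>\<in>T. length \<tau> = m \<and> prefix \<sigma> \<tau>" by blast
  qed (use \<open>is_tree T\<close> T_F in auto)
  show thesis
  proof
    show "is_tree T" by fact
    obtain \<sigma> where "\<sigma> \<in> F 0" "length \<sigma> = n 0" using level by blast
    then have "\<sigma> \<in> Ext T" using pure_limit_Ext limit by blast
    then show "infinite T" unfolding Ext_def by (auto dest: finite_subset[rotated])
    show "avoids (witness_segs T) (char_graph (bcode ` T))"
      unfolding avoids_def
    proof
      fix a :: code
      show "\<not> deadend_free (witness_segs T) (ap a (char_graph (bcode ` T)))"
        using c(2)[of "to_nat a"] limit[of "Suc (to_nat a)"] unfolding Q_def n_def F_def by simp
    qed
  qed
qed

section \<open>The model\<close>

text \<open>In use \<open>Z\<close> is a characteristic graph or a nested join of such graphs, which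
  need not be one itself; so only the output is asked to be a characteristic graph.\<close>

definition ideal_of :: "nat set \<Rightarrow> nat set set" where
  "ideal_of Z = {B. \<exists>a. ap a Z = char_graph B}"

lemma ideal_of_closed:
  assumes "B \<in> ideal_of Z" "ap a (char_graph B) = char_graph C"
  shows "C \<in> ideal_of Z"
proof -
  obtain b where "ap b Z = char_graph B" using assms(1) unfolding ideal_of_def by blast
  then have "ap (Compose a b) Z = char_graph C" using assms(2) by simp
  then show ?thesis unfolding ideal_of_def by blast
qed

lemma ideal_of_turing_reducible:
  assumes "B \<in> ideal_of Z" "turing_reducible C B"
  shows "C \<in> ideal_of Z"
proof -
  obtain e where "\<forall>x. eval B e [x] (if x \<in> C then 1 else 0)"
    using assms(2) unfolding turing_reducible_def by blast
  then have "ap (Turing e) (char_graph B) = char_graph C" using turing_op_char_graph by simp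
  then show ?thesis by (rule ideal_of_closed[OF assms(1)])
qed

lemma join_op_char_graph: "join_op (char_graph A) (char_graph B) = char_graph (tjoin A B)"
proof (rule char_graph_eqI)
  fix x :: nat and b
  obtain y c where x: "x = 2 * y + of_bool c" by (rule double_of_bool_cases)
  have eqs: "2 * Suc (2 * z) = 2 * (2 * z + of_bool True)" "2 * (2 * z) = 2 * (2 * z + of_bool False)"
    for z :: nat by simp_all
  show "2 * x + of_bool b \<in> join_op (char_graph A) (char_graph B) \<longleftrightarrow> (b \<longleftrightarrow> x \<in> tjoin A B)"
    unfolding x join_op_def eqs Un_iff mem_Collect_eq double_of_bool_eq_iff
    by (cases c) (auto simp: in_char_graph_iff)
qed

lemma ideal_of_tjoin:
  assumes "A \<in> ideal_of Z" "B \<in> ideal_of Z"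
  shows "tjoin A B \<in> ideal_of Z"
proof -
  obtain a b where "ap a Z = char_graph A" "ap b Z = char_graph B"
    using assms unfolding ideal_of_def by blast
  then have "ap (Join a b) Z = char_graph (tjoin A B)" by (simp add: join_op_char_graph)
  then show ?thesis unfolding ideal_of_def by blast
qed

lemma ideal_of_base: "B \<in> ideal_of (char_graph B)"
  unfolding ideal_of_def mem_Collect_eq by (rule exI[of _ Ident]) simp

lemma ideal_of_tjoin_left: "ideal_of Z \<subseteq> ideal_of (tjoin Z W)"
proof
  fix B assume "B \<in> ideal_of Z"
  then obtain a where "ap a Z = char_graph B" unfolding ideal_of_def by blast
  then have "ap (Compose a Left) (tjoin Z W) = char_graph B" by simp
  then show "B \<in> ideal_of (tjoin Z W)" unfolding ideal_of_def by blast
qed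

lemma ideal_of_tjoin_right: "B \<in> ideal_of (tjoin Z (char_graph B))"
proof -
  have "ap Right (tjoin Z (char_graph B)) = char_graph B" by simp
  then show ?thesis unfolding ideal_of_def by blast
qed

text \<open>The displayed set, a single infinite branch, is what \<open>path_segs\<close> and
  \<open>fun_segs\<close> give on the characteristic graph of a path or of the graph of a
  function.\<close>

lemma deadend_free_segs:
  assumes "\<And>n. map h [0..<n] \<in> P"
  shows "deadend_free P {list_encode s | s. \<forall>i<length s. s ! i = h i}"
proof -
  have segs: "{list_encode s | s. \<forall>i<length s. s ! i = h i} = range (\<lambda>n. list_encode (map h [0..<n]))"
  proof (intro subset_antisym subsetI)
    fix w assume "w \<in> {list_encode s | s. \<forall>i<length s. s ! i = h i}"
    then obtain s where "w = list_encode s" "\<forall>i<length s. s ! i = h i" by blast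
    moreover then have "s = map h [0..<length s]" by (intro nth_equalityI) auto
    ultimately show "w \<in> range (\<lambda>n. list_encode (map h [0..<n]))" by (metis rangeI)
  next
    fix w assume "w \<in> range (\<lambda>n. list_encode (map h [0..<n]))"
    then obtain n where "w = list_encode (map h [0..<n])" by blast
    moreover have "\<forall>i<length (map h [0..<n]). map h [0..<n] ! i = h i" by simp
    ultimately show "w \<in> {list_encode s | s. \<forall>i<length s. s ! i = h i}" by blast
  qed
  have "strict_prefix (map h [0..<n]) (map h [0..<Suc n])" for n
    by (simp add: strict_prefix_def)
  then show ?thesis unfolding segs deadend_free_def using assms by (simp only: ball_simps bex_simps list_encode_inverse) blast
qed

lemma avoids_no_path:
  assumes T: "is_tree T" and Z: "avoids (witness_segs T) Z" and p: "{n. p n} \<in> ideal_of Z"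
  shows "\<not> is_path T p"
proof
  assume path: "is_path T p"
  obtain a where a: "ap a Z = char_graph {n. p n}" using p unfolding ideal_of_def by blast
  \<comment> \<open>On a characteristic graph the two conditions in \<open>path_segs\<close> leave
    exactly the bit of \<open>p\<close> as entry.\<close>
  have "s \<le> 1 \<and> 2 * i + s \<in> char_graph {n. p n} \<longleftrightarrow> s = of_bool (p i)" for i s :: nat
    using char_graph_mem0[of i "{n. p n}"] char_graph_mem1[of i "{n. p n}"]
    by (cases "s = 0"; cases "s = 1") auto
  then have "ap (Compose Path_Segs a) Z = {list_encode s | s. \<forall>i<length s. s ! i = of_bool (p i)}"
    by (simp add: a path_segs_def)
  moreover have "map (\<lambda>n. of_bool (p n)) [0..<n] \<in> witness_segs T" for n
  proof -
    have "prefix (map p [0..<n]) (map p [0..<m])" if "n \<le> m" for m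
      using that by (metis add_0 take_is_prefix take_map take_upt)
    then have "map p [0..<n] \<in> Ext T"
      using path unfolding Ext_iff[OF T] is_path_def by (metis diff_zero length_map length_upt)
    then show ?thesis unfolding witness_segs_def by (simp add: comp_def)
  qed
  ultimately have "deadend_free (witness_segs T) (ap (Compose Path_Segs a) Z)"
    by (simp only: deadend_free_segs)
  then show False using Z unfolding avoids_def by blast
qed

lemma avoids_no_bound:
  assumes Z: "avoids (witness_segs T) Z" and f: "fun_graph f \<in> ideal_of Z"
  shows "\<not> (\<forall>\<sigma>\<in>Ext T. \<exists>\<tau>\<in>Br T. prefix \<sigma> \<tau> \<and> length \<tau> \<le> f (length \<sigma>))"
proof
  assume bound: "\<forall>\<sigma>\<in>Ext T. \<exists>\<tau>\<in>Br T. prefix \<sigma> \<tau> \<and> length \<tau> \<le> f (length \<sigma>)"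
  obtain a where a: "ap a Z = char_graph (fun_graph f)" using f unfolding ideal_of_def by blast
  have "ap (Compose Fun_Segs a) Z = {list_encode s | s. \<forall>i<length s. s ! i = f i}"
    by (simp add: a fun_segs_def char_graph_mem1 in_fun_graph_iff)
  moreover have "map f [0..<n] \<in> witness_segs T" for n
    unfolding witness_segs_def using bound by auto
  ultimately have "deadend_free (witness_segs T) (ap (Compose Fun_Segs a) Z)"
    by (simp only: deadend_free_segs)
  then show False using Z unfolding avoids_def by blast
qed

section \<open>Counting branching levels\<close>

lemma Ex_card_le_of_infinite:
  assumes "infinite (L :: nat set)"
  shows "\<exists>N. n \<le> card {l \<in> L. l < N}"
proof -
  obtain D where D: "D \<subseteq> L" "finite D" "card D = n"
    using infinite_arbitrarily_large[OF assms] by metis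
  obtain N where "\<forall>l\<in>D. l < N" using D(2) finite_nat_set_iff_bounded by auto
  then have "D \<subseteq> {l \<in> L. l < N}" using D(1) by blast
  then have "n \<le> card {l \<in> L. l < N}" unfolding D(3)[symmetric] by (intro card_mono) auto
  then show ?thesis by blast
qed

definition Br_levels :: "bool list set \<Rightarrow> nat set" where
  "Br_levels T = {length \<sigma> | \<sigma>. \<sigma> \<in> Br T}"

lemma Br_levels_below: "{length \<sigma> | \<sigma>. \<sigma> \<in> Br T \<and> length \<sigma> < N} = {l \<in> Br_levels T. l < N}"
  unfolding Br_levels_def by auto

text \<open>\<open>Br_levels\<close> need not be computable from \<open>Z\<close>, but genericity
  defeats arbitrary functions: infinitely often \<open>f\<close> reaches a place below which
  \<open>n\<close> branching levels lie, for all trees of the ideal at once.\<close>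

lemma Cohen_escape:
  assumes "avoids P Z"
  obtains f where "avoids P (tjoin Z (char_graph (fun_graph f)))"
    "\<And>T. bcode ` T \<in> ideal_of Z \<Longrightarrow> infinite (Br_levels T) \<Longrightarrow>
      infinite {n. n \<le> card {l \<in> Br_levels T. l < f n}}"
proof -
  define S where "S i = {\<sigma>. Suc (2 * bcode \<sigma>) \<in> ap (from_nat i) Z}" for i
  \<comment> \<open>The least number may be unspecified if \<open>S i\<close> has finitely many
    branching levels; it is evaluated only for trees with infinitely many.\<close>
  define p where "p i n = (LEAST N. n \<le> card {l \<in> Br_levels (S i). l < N})" for i n
  obtain f where f: "avoids P (tjoin Z (char_graph (fun_graph f)))" "\<And>i. infinite {n. p i n \<le> f n}"
    using Cohen_extension[OF assms, of p] by blast
  show thesis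
  proof (rule that[OF f(1)])
    fix T assume "bcode ` T \<in> ideal_of Z" and inf: "infinite (Br_levels T)"
    then obtain a where a: "ap a Z = char_graph (bcode ` T)" unfolding ideal_of_def by blast
    have T: "T = S (to_nat a)" unfolding S_def by (simp add: a char_graph_mem1)
    have "n \<le> card {l \<in> Br_levels T. l < f n}" if "p (to_nat a) n \<le> f n" for n
    proof -
      have "n \<le> card {l \<in> Br_levels T. l < p (to_nat a) n}"
        unfolding p_def T[symmetric] by (rule LeastI_ex) (rule Ex_card_le_of_infinite[OF inf])
      also have "\<dots> \<le> card {l \<in> Br_levels T. l < f n}"
        using that by (intro card_mono) auto
      finally show ?thesis .
    qed
    then have "{n. p (to_nat a) n \<le> f n} \<subseteq> {n. n \<le> card {l \<in> Br_levels T. l < f n}}" by blast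
    then show "infinite {n. n \<le> card {l \<in> Br_levels T. l < f n}}"
      using f(2) finite_subset by blast
  qed
qed

text \<open>An extendible node past all branching levels isolates a path. The node enters
  \<open>Path \<sigma>\<close> as a parameter, chosen without uniformity in the tree.\<close>

lemma path_of_finite_Br_levels:
  assumes T: "is_tree T" "infinite T" and fin: "finite (Br_levels T)" and Z: "bcode ` T \<in> ideal_of Z"
  obtains p where "is_path T p" "{n. p n} \<in> ideal_of Z"
proof -
  obtain m where m: "\<forall>l\<in>Br_levels T. l < m" using fin finite_nat_set_iff_bounded by blast
  obtain \<sigma> where \<sigma>: "\<sigma> \<in> Ext T" "length \<sigma> = m"
    using Ext_extension[OF T(1) Nil_in_Ext[OF T], of m] by auto
  have "length \<tau> < length \<sigma>" if "\<tau> \<in> Br T" for \<tau>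
    using that m \<sigma>(2) unfolding Br_levels_def by blast
  then obtain p where p: "is_path T p" "path_op \<sigma> (char_graph (bcode ` T)) = char_graph {n. p n}"
    using path_op_isolated_path[OF T(1) \<sigma>(1)] by blast
  have "{n. p n} \<in> ideal_of Z"
    by (rule ideal_of_closed[OF Z, of "Path \<sigma>"]) (simp add: p(2))
  then show thesis using that p(1) by blast
qed

theorem mainTheorem9:
  shows "\<exists>M. turing_ideal M \<and> VSMALL_holds M \<and> \<not> DIM_holds M"
proof -
  obtain T where T: "is_tree T" "infinite T" "avoids (witness_segs T) (char_graph (bcode ` T))"
    by (rule generic_tree_exists)
  \<comment> \<open>One stage adds a Cohen function that escapes the branching levels of all trees
    in the ideal generated so far.\<close>
  define Q where "Q Z Z' \<longleftrightarrow> (\<exists>f. Z' = tjoin Z (char_graph (fun_graph f)) \<and>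
    (\<forall>S. bcode ` S \<in> ideal_of Z \<longrightarrow> infinite (Br_levels S) \<longrightarrow>
      infinite {n. n \<le> card {l \<in> Br_levels S. l < f n}}))" for Z Z'
  have "\<exists>Z'. avoids (witness_segs T) Z' \<and> Q Z Z'" if "avoids (witness_segs T) Z" for Z
    unfolding Q_def using Cohen_escape[OF that] by metis
  then have "\<exists>Z. \<forall>k. (avoids (witness_segs T) (Z k) \<and> (k = 0 \<longrightarrow> Z k = char_graph (bcode ` T))) \<and>
      Q (Z k) (Z (Suc k))"
    by (intro dependent_nat_choice) (use T(3) in auto)
  then obtain Z where Z: "Z 0 = char_graph (bcode ` T)"
    "\<And>k. avoids (witness_segs T) (Z k)" "\<And>k. Q (Z k) (Z (Suc k))" by auto
  define M where "M = (\<Union>k. ideal_of (Z k))"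
  have "ideal_of (Z k) \<subseteq> ideal_of (Z (Suc k))" for k
  proof -
    obtain f where "Z (Suc k) = tjoin (Z k) (char_graph (fun_graph f))"
      using Z(3)[of k] unfolding Q_def by metis
    then show ?thesis by (simp only: ideal_of_tjoin_left)
  qed
  then have mono: "ideal_of (Z j) \<subseteq> ideal_of (Z k)" if "j \<le> k" for j k
    using that by (rule lift_Suc_mono_le)
  have T_M: "bcode ` T \<in> M"
    using ideal_of_base[of "bcode ` T"] unfolding M_def Z(1)[symmetric] by blast
  have "turing_ideal M" unfolding turing_ideal_def
  proof (intro conjI ballI allI impI)
    show "M \<noteq> {}" using T_M by blast
    fix A B assume "A \<in> M" "B \<in> M"
    then obtain i j where "A \<in> ideal_of (Z i)" "B \<in> ideal_of (Z j)" unfolding M_def by blast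
    then have "A \<in> ideal_of (Z (max i j))" "B \<in> ideal_of (Z (max i j))"
      using mono[of i "max i j"] mono[of j "max i j"] by auto
    then show "tjoin A B \<in> M" unfolding M_def using ideal_of_tjoin by blast
  next
    fix A B assume "A \<in> M" "turing_reducible B A"
    then show "B \<in> M" unfolding M_def using ideal_of_turing_reducible by blast
  qed
  moreover have "VSMALL_holds M" unfolding VSMALL_holds_def
  proof (intro allI impI)
    fix S assume S: "tree_in M S \<and> is_tree S \<and> infinite S \<and> VSMALL_hyp M S"
    then obtain k where k: "bcode ` S \<in> ideal_of (Z k)" unfolding tree_in_def M_def by blast
    \<comment> \<open>The escaping function enters one stage after the tree, hence still inside
      \<open>M\<close>; it refutes the hypothesis of VSMALL unless there are finitely many branching
      levels.\<close>
    obtain f where f: "Z (Suc k) = tjoin (Z k) (char_graph (fun_graph f))"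
      "infinite (Br_levels S) \<Longrightarrow> infinite {n. n \<le> card {l \<in> Br_levels S. l < f n}}"
      using Z(3)[of k] k unfolding Q_def by blast
    have "fun_graph f \<in> M"
      using ideal_of_tjoin_right[of "fun_graph f" "Z k"] unfolding M_def f(1)[symmetric] by blast
    then have "fun_in M f" unfolding fun_in_def fun_graph_def .
    then have "finite (Br_levels S)"
      using S f(2) unfolding VSMALL_hyp_def Br_levels_below by blast
    then obtain p where "is_path S p" "{n. p n} \<in> ideal_of (Z k)"
      using path_of_finite_Br_levels S k by blast
    then show "\<exists>p. path_in M p \<and> is_path S p" unfolding path_in_def M_def by blast
  qed
  moreover have "\<not> DIM_holds M"
  proof
    assume "DIM_holds M"
    \<comment> \<open>A bound in \<open>M\<close> would occur at a finite stage, where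
      \<open>avoids\<close> excludes it; paths are excluded in the same way.\<close>
    moreover have "DIM_hyp M T" unfolding DIM_hyp_def
    proof
      assume "\<exists>f. fun_in M f \<and>
        (\<forall>\<sigma>\<in>Ext T. \<exists>\<tau>\<in>Br T. prefix \<sigma> \<tau> \<and> length \<tau> \<le> f (length \<sigma>))"
      then obtain f k where "fun_graph f \<in> ideal_of (Z k)"
        "\<forall>\<sigma>\<in>Ext T. \<exists>\<tau>\<in>Br T. prefix \<sigma> \<tau> \<and> length \<tau> \<le> f (length \<sigma>)"
        unfolding fun_in_def fun_graph_def[symmetric] M_def by blast
      then show False using avoids_no_bound Z(2) by blast
    qed
    ultimately obtain p k where "is_path T p" "{n. p n} \<in> ideal_of (Z k)"
      using T T_M unfolding DIM_holds_def tree_in_def path_in_def M_def by blast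
    then show False using avoids_no_path T(1) Z(2) by blast
  qed
  ultimately show ?thesis by blast
qed

end
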